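(* Let $\alpha,\delta,\zeta,\eta\in\mathbb{R}$ and consider the projected synchronous-loss model of SH-SVL described in the context, where packets are lost synchronously in the whole network, independently and identically distributed over time, with probability $p_\ell$, and put $p_s=1-p_\ell$. Suppose there exist symmetric $P,Q\in\mathbb{R}^{3\times 3}$, $\lambda_0,\lambda_1\in\mathbb{R}$ and $\rho\in(0,1)$ with $P\succ 0$, $Q\succ 0$, $\lambda_0\ge 0$, $\lambda_1\ge 0$ such that $$\sum_{o\in\{s,\ell\}} p_o\,[\star]^{\top}\begin{bmatrix}P&0&0\\0&-\rho^2P&0\\0&0&\lambda_0M_0\end{bmatrix}\begin{bmatrix}A_{op}&B_{opu}\\ I_3&0\\ c_x&0\\ 0&1\end{bmatrix}\preceq 0$$ and $$\sum_{o\in\{s,\ell\}} p_o\,[\star]^{\top}\begin{bmatrix}Q&0&0&0\\0&-\rho^2Q&0&0\\0&0&\lambda_0M_0&0\\0&0&0&\lambda_1M_1\end{bmatrix}\begin{bmatrix}A_{oq}&B_{oqu}&B_{oqv}\\ I_3&0&0\\ c_x&0&-1\\ 0&1&0\\ c_y&0&0\\ 0&0&1\end{bmatrix}\preceq 0 .$$ Then there is a fixed point $(w_1^\star,\hat w_2^\star,r^\star,x^\star,\hat y^\star,u^\star,v^\star)$ of the model such that its trajectories satisfy, for all $k\ge 0$, $$\mathbb{E}\left[\left\|\begin{bmatrix}w_1^k-w_1^\star\\ \hat w_2^k-\hat w_2^\star\\ \hat r^k-r^\star\end{bmatrix}\right\|^2\right]\le \operatorname{cond}(T)\,\rho^{2k}\left\|\begin{bmatrix}w_1^0-w_1^\star\\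 \hat w_2^0-\hat w_2^\star\\ \hat r^0-r^\star\end{bmatrix}\right\|^2,\qquad T=P\otimes\Pi+Q\otimes(I-\Pi).$$ Consequently the output $x^k$ converges in mean square to the optimizer $\mathbf{1}x_{\rm opt}$ with linear rate $\rho$ (i.e. $\mathbb{E}\|x^k-\mathbf{1}x_{\rm opt}\|^2\le c\,\rho^{2k}$ for some constant $c$), and $x^k$ also converges to $\mathbf{1}x_{\rm opt}$ almost surely.
   Context: **Problem and standing assumptions.** $n$ agents; agent $i$ has a differentiable convex local cost $f_i:\mathbb{R}\to\mathbb{R}$ (the decision dimension is $d=1$). $x_{\rm opt}=\arg\min_\theta\sum_i f_i(\theta)$ is assumed unique and satisfies $\sum_i\nabla f_i(x_{\rm opt})=0$. Let $\mathbf{1}\in\mathbb{R}^n$ be the all-ones vector, $I=I_n$, $\Pi=\frac1n\mathbf{1}\mathbf{1}^\top$; for $x\in\mathbb{R}^n$, $\nabla F(x)=(\nabla f_1(x_1),\dots,\nabla f_n(x_n))^\top$. $\|\cdot\|$ is the Euclidean vector norm / spectral matrix norm; $\operatorname{cond}(T)=\lambda_{\max}(T)/\lambda_{\min}(T)$ for symmetric $T$; $[\star]^\top A X$ means $X^\top A X$; $\otimes$ is the Kronecker product. (A1) For given $0<\mu\le L$ and all $i$ and $x_i\in\mathbb{R}$, with $a=x_i-x_{\rm opt}$, $b=\nabla f_i(x_i)-\nabla f_i(x_{\rm opt})$: $-2\mu L a^2+2(L+\mu)ab-2b^2\ge0$. (A2) The communication graph $\mathcal G$, a weighted digraph on $\{1,\dots,n\}$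 with edge $(i,j)$ meaning that $i$ can receive from $j$, is strongly connected. Its weighted Laplacian $\mathcal L\in\mathbb{R}^{n\times n}$ has $-\mathcal L_{ij}$ equal to the weight of edge $(i,j)$, $\mathcal L_{ij}=0$ if $i\ne j$ and $(i,j)$ is not an edge, $\mathcal L_{ii}=-\sum_{j\ne i}\mathcal L_{ij}$ (so $\mathcal L\mathbf{1}=0$). (A3) $\mathbf{1}^\top\mathcal L=0$. (A4) $\sigma:=\|I-\Pi-\mathcal L\|<1$. **SH-SVL.** With parameters $\alpha,\delta,\zeta,\eta$, each agent $i$ at time $k$ sends $y_i^k=\delta w_{1i}^k+\eta w_{2i}^k$; for each in-neighbor $j$ (and $j=i$) it sets $r_{ij}^k=y_j^k$ if the packet from $j$ is received and $r_{ij}^k=\eta x_i^{k-1}+r_{ij}^{k-1}$ otherwise; then $v_i^k=\sum_j\mathcal L_{ij}r_{ij}^k$, $x_i^k=w_{1i}^k-v_i^k$ (its output, the estimate of the optimizer), $u_i^k=\nabla f_i(x_i^k)$, $w_{1i}^{k+1}=w_{1i}^k-\alpha u_i^k-\zeta v_i^k$, $w_{2i}^{k+1}=w_{1i}^k+w_{2i}^k-v_i^k$. **Projected synchronous-loss model.** Synchronous loss: at each time step, either all packets in the network (including an agent's own message to itself) succeed, with probability $1-p_\ell$, or all are lost, with probability $p_\ell$, independently over time. Since terms $\eta x_i\mathbf{1}$ are annihilated by $\mathcal L$, all agents' memories are represented by one vector $\hat r^k\in\mathbb{R}^n$, and $w_2$ is replaced by its projection $\hat w_2=(I-\Pi)w_2$;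 this does not change $x^k$. The output of SH-SVL under synchronous loss is thus the signal $x^k$ of the following system with state $(w_1^k,\hat w_2^k,\hat r^k)$ (deterministic initial state): $v^k=\mathcal L\hat r^k$, $x^k=w_1^k-v^k$, $u^k=\nabla F(x^k)$, $w_1^{k+1}=w_1^k-\alpha u^k-\zeta v^k$, $\hat w_2^{k+1}=(I-\Pi)(w_1^k+\hat w_2^k-v^k)$, $\hat r^{k+1}=\delta w_1^{k+1}+\eta\hat w_2^{k+1}$ on success, and $\hat r^{k+1}=\hat r^k$ on loss. Equivalently, the state $\xi=(w_1,\hat w_2,\hat r)$ evolves by $\xi^{k+1}=A_{o}\xi^k+B_{ou}u^k+B_{ov}v^k$ with $o=s$ (success) or $o=\ell$ (loss), $A_o=A_{op}\otimes\Pi+A_{oq}\otimes(I-\Pi)$, $B_{ou}=B_{opu}\otimes\Pi+B_{oqu}\otimes(I-\Pi)$, $B_{ov}=B_{opv}\otimes\Pi+B_{oqv}\otimes(I-\Pi)$. A fixed point is a tuple with $w_1^\star=w_1^\star-\alpha u^\star-\zeta v^\star$, $\hat w_2^\star=(I-\Pi)(w_1^\star+\hat w_2^\star-v^\star)$, $r^\star=\hat y^\star=\delta w_1^\star+\eta\hat w_2^\star$, $x^\star=w_1^\star-v^\star$, $u^\star=\nabla F(x^\star)$, $v^\star=\mathcal L r^\star$. **Matrices.** $A_{sp}=\begin{bmatrix}1&0&0\\0&0&0\\\delta&0&0\end{bmatrix}$, $B_{spu}=\begin{bmatrix}-\alpha\\0\\-\alpha\delta\end{bmatrix}$, $B_{spv}=\begin{bmatrix}-\zeta\\0\\-\delta\zeta\end{bmatrix}$,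 $A_{sq}=\begin{bmatrix}1&0&0\\1&1&0\\\delta+\eta&\eta&0\end{bmatrix}$, $B_{squ}=\begin{bmatrix}-\alpha\\0\\-\alpha\delta\end{bmatrix}$, $B_{sqv}=\begin{bmatrix}-\zeta\\-1\\-\delta\zeta-\eta\end{bmatrix}$, $A_{\ell p}=\begin{bmatrix}1&0&0\\0&0&0\\0&0&1\end{bmatrix}$, $B_{\ell pu}=\begin{bmatrix}-\alpha\\0\\0\end{bmatrix}$, $B_{\ell pv}=\begin{bmatrix}-\zeta\\0\\0\end{bmatrix}$, $A_{\ell q}=\begin{bmatrix}1&0&0\\1&1&0\\0&0&1\end{bmatrix}$, $B_{\ell qu}=\begin{bmatrix}-\alpha\\0\\0\end{bmatrix}$, $B_{\ell qv}=\begin{bmatrix}-\zeta\\-1\\0\end{bmatrix}$, $c_x=\begin{bmatrix}1&0&0\end{bmatrix}$, $c_y=\begin{bmatrix}0&0&1\end{bmatrix}$, $M_0=\begin{bmatrix}-2\mu L&L+\mu\\L+\mu&-2\end{bmatrix}$, $M_1=\begin{bmatrix}\sigma^2-1&1\\1&-1\end{bmatrix}$. *)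

theory Defs
  imports "HOL-Probability.Probability" "Graph_Theory.Pair_Digraph" "Graph_Theory.Digraph_Component"
begin

section \<open>Matrices\<close>

text \<open>Block matrices are indexed by sum types, Kronecker products by product types.\<close>

definition hcat :: "real^'b^'a \<Rightarrow> real^'c^'a \<Rightarrow> real^('b::finite + 'c::finite)^'a" where
  "hcat A B = (\<chi> i j. case j of Inl k \<Rightarrow> A $ i $ k | Inr k \<Rightarrow> B $ i $ k)"

definition vcat :: "real^'c^'a \<Rightarrow> real^'c^'b \<Rightarrow> real^'c^('a::finite + 'b::finite)" where
  "vcat A B = (\<chi> i. case i of Inl k \<Rightarrow> A $ k | Inr k \<Rightarrow> B $ k)"

definition block_diag ::
  "real^'a^'a \<Rightarrow> real^'b^'b \<Rightarrow> real^('a::finite + 'b::finite)^('a + 'b)" where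
  "block_diag A B = vcat (hcat A 0) (hcat 0 B)"

definition kron :: "real^'b^'a \<Rightarrow> real^'d^'c \<Rightarrow> real^('b::finite \<times> 'd::finite)^('a::finite \<times> 'c::finite)"
  (infixl "\<otimes>\<^sub>K" 75) where
  "A \<otimes>\<^sub>K B = (\<chi> i j. A $ fst i $ fst j * B $ snd i $ snd j)"

text \<open>The quadratic form written \<open>[\<star>]\<^sup>T A X\<close>.\<close>

definition sandwich :: "real^'m^'m \<Rightarrow> real^'k^'m \<Rightarrow> real^'k^'k" where
  "sandwich A X = transpose X ** A ** X"

definition pos_def :: "real^'m^'m \<Rightarrow> bool" where
  "pos_def A \<longleftrightarrow> transpose A = A \<and> (\<forall>x. x \<noteq> 0 \<longrightarrow> x \<bullet> (A *v x) > 0)"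

definition neg_semidef :: "real^'m^'m \<Rightarrow> bool" where
  "neg_semidef A \<longleftrightarrow> transpose A = A \<and> (\<forall>x. x \<bullet> (A *v x) \<le> 0)"

definition eigenvals :: "real^'m^'m \<Rightarrow> real set" where
  "eigenvals A = {c. \<exists>v. v \<noteq> 0 \<and> A *v v = c *\<^sub>R v}"

definition cond :: "real^'m^'m \<Rightarrow> real" where
  "cond A = Max (eigenvals A) / Min (eigenvals A)"

definition spectral_norm :: "real^'m^'k \<Rightarrow> real" where
  "spectral_norm A = onorm ((*v) A)"

definition avg_proj :: "real^'n^'n" where
  "avg_proj = (\<chi> i j. 1 / real CARD('n))"

section \<open>Graph Laplacian\<close>

text \<open>An arc \<open>(i, j)\<close> means that agent \<open>i\<close> can receive from agent \<open>j\<close>; its weight is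
  \<open>wt i j\<close>. Weights may be any reals; the diagonal is fixed by zero row sums.\<close>

definition laplacian :: "'n pair_pre_digraph \<Rightarrow> ('n \<Rightarrow> 'n \<Rightarrow> real) \<Rightarrow> real^'n^'n" where
  "laplacian G wt = (\<chi> i j.
     if i = j then (\<Sum>k \<in> {k. k \<noteq> i \<and> (i, k) \<in> parcs G}. wt i k)
     else if (i, j) \<in> parcs G then - wt i j else 0)"

section \<open>Projected synchronous-loss model\<close>

datatype outcome = Success | Loss

definition gradF :: "('n \<Rightarrow> real \<Rightarrow> real) \<Rightarrow> real^'n \<Rightarrow> real^'n" where
  "gradF f x = (\<chi> i. deriv (f i) (x $ i))"

text \<open>The state \<open>(w\<^sub>1, \<hat>w\<^sub>2, \<hat>r)\<close> is a triple. The norm of a product type is the Euclidean one,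
  so the norm of such a triple is that of the stacked vector.\<close>

type_synonym 'n state = "(real^'n) \<times> (real^'n) \<times> (real^'n)"

fun x_out :: "real^'n^'n \<Rightarrow> 'n::finite state \<Rightarrow> real^'n" where
  "x_out lap (w1, w2, r) = w1 - lap *v r"

fun step :: "('n \<Rightarrow> real \<Rightarrow> real) \<Rightarrow> real^'n^'n \<Rightarrow> real \<Rightarrow> real \<Rightarrow> real \<Rightarrow> real \<Rightarrow>
    outcome \<Rightarrow> 'n::finite state \<Rightarrow> 'n state" where
  "step f lap \<alpha> \<delta> \<zeta> \<eta> out (w1, w2, r) =
    (let v = lap *v r;
         x = w1 - v;
         u = gradF f x;
         w1' = w1 - \<alpha> *\<^sub>R u - \<zeta> *\<^sub>R v;
         w2' = (mat 1 - avg_proj) *v (w1 + w2 - v);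
         r' = (case out of Success \<Rightarrow> \<delta> *\<^sub>R w1' + \<eta> *\<^sub>R w2' | Loss \<Rightarrow> r)
     in (w1', w2', r'))"

text \<open>\<open>net k\<close> is the outcome of the transmissions at time \<open>k\<close>. The packets sent at time \<open>k + 1\<close>
  carry \<open>\<delta> w\<^sub>1\<^sup>k\<^sup>+\<^sup>1 + \<eta> w\<^sub>2\<^sup>k\<^sup>+\<^sup>1\<close>, so \<open>net (Suc k)\<close> decides the update of the memory to its value
  at time \<open>k + 1\<close>.\<close>

primrec traj :: "('n \<Rightarrow> real \<Rightarrow> real) \<Rightarrow> real^'n^'n \<Rightarrow> real \<Rightarrow> real \<Rightarrow> real \<Rightarrow> real \<Rightarrow>
    'n::finite state \<Rightarrow> (nat \<Rightarrow> outcome) \<Rightarrow> nat \<Rightarrow> 'n state" where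
  "traj f lap \<alpha> \<delta> \<zeta> \<eta> \<xi>0 net 0 = \<xi>0"
| "traj f lap \<alpha> \<delta> \<zeta> \<eta> \<xi>0 net (Suc k) =
     step f lap \<alpha> \<delta> \<zeta> \<eta> (net (Suc k)) (traj f lap \<alpha> \<delta> \<zeta> \<eta> \<xi>0 net k)"

definition is_fixed_point :: "('n \<Rightarrow> real \<Rightarrow> real) \<Rightarrow> real^'n^'n \<Rightarrow> real \<Rightarrow> real \<Rightarrow> real \<Rightarrow> real \<Rightarrow>
    real^'n \<Rightarrow> real^'n \<Rightarrow> real^'n \<Rightarrow> real^'n \<Rightarrow> real^'n \<Rightarrow> real^'n \<Rightarrow> real^'n::finite \<Rightarrow> bool" where
  "is_fixed_point f lap \<alpha> \<delta> \<zeta> \<eta> w1 w2 r x y u v \<longleftrightarrow>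
     w1 = w1 - \<alpha> *\<^sub>R u - \<zeta> *\<^sub>R v \<and>
     w2 = (mat 1 - avg_proj) *v (w1 + w2 - v) \<and>
     r = y \<and> y = \<delta> *\<^sub>R w1 + \<eta> *\<^sub>R w2 \<and>
     x = w1 - v \<and> u = gradF f x \<and> v = lap *v r"

section \<open>Matrix inequalities\<close>

fun prob_out :: "real \<Rightarrow> outcome \<Rightarrow> real" where
  "prob_out pl Success = 1 - pl"
| "prob_out pl Loss = pl"

fun A_p :: "real \<Rightarrow> outcome \<Rightarrow> real^3^3" where
  "A_p \<delta> Success = vector [vector [1, 0, 0], vector [0, 0, 0], vector [\<delta>, 0, 0]]"
| "A_p \<delta> Loss = vector [vector [1, 0, 0], vector [0, 0, 0], vector [0, 0, 1]]"

fun B_pu :: "real \<Rightarrow> real \<Rightarrow> outcome \<Rightarrow> real^1^3" where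
  "B_pu \<alpha> \<delta> Success = vector [vector [- \<alpha>], vector [0], vector [- \<alpha> * \<delta>]]"
| "B_pu \<alpha> \<delta> Loss = vector [vector [- \<alpha>], vector [0], vector [0]]"

fun A_q :: "real \<Rightarrow> real \<Rightarrow> outcome \<Rightarrow> real^3^3" where
  "A_q \<delta> \<eta> Success = vector [vector [1, 0, 0], vector [1, 1, 0], vector [\<delta> + \<eta>, \<eta>, 0]]"
| "A_q \<delta> \<eta> Loss = vector [vector [1, 0, 0], vector [1, 1, 0], vector [0, 0, 1]]"

fun B_qu :: "real \<Rightarrow> real \<Rightarrow> outcome \<Rightarrow> real^1^3" where
  "B_qu \<alpha> \<delta> Success = vector [vector [- \<alpha>], vector [0], vector [- \<alpha> * \<delta>]]"
| "B_qu \<alpha> \<delta> Loss = vector [vector [- \<alpha>], vector [0], vector [0]]"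

fun B_qv :: "real \<Rightarrow> real \<Rightarrow> real \<Rightarrow> outcome \<Rightarrow> real^1^3" where
  "B_qv \<delta> \<zeta> \<eta> Success = vector [vector [- \<zeta>], vector [- 1], vector [- \<delta> * \<zeta> - \<eta>]]"
| "B_qv \<delta> \<zeta> \<eta> Loss = vector [vector [- \<zeta>], vector [- 1], vector [0]]"

definition c_x :: "real^3^1" where
  "c_x = vector [vector [1, 0, 0]]"

definition c_y :: "real^3^1" where
  "c_y = vector [vector [0, 0, 1]]"

text \<open>The $2 \times 2$ matrices are indexed by \<open>1 + 1\<close> so that they fit the block rows below;
  \<open>mat c\<close> at type \<^typ>\<open>real^1^1\<close> is the scalar \<open>c\<close>.\<close>

definition M_0 :: "real \<Rightarrow> real \<Rightarrow> real^(1 + 1)^(1 + 1)" where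
  "M_0 \<mu> L = vcat (hcat (mat (- 2 * \<mu> * L)) (mat (L + \<mu>)))
                  (hcat (mat (L + \<mu>)) (mat (- 2)))"

definition M_1 :: "real \<Rightarrow> real^(1 + 1)^(1 + 1)" where
  "M_1 \<sigma> = vcat (hcat (mat (\<sigma>\<^sup>2 - 1)) (mat 1))
                (hcat (mat 1) (mat (- 1)))"

definition lmi_p :: "real \<Rightarrow> real \<Rightarrow> real \<Rightarrow> real \<Rightarrow> real \<Rightarrow> real^3^3 \<Rightarrow> real \<Rightarrow> real \<Rightarrow>
    real^(3 + 1)^(3 + 1)" where
  "lmi_p \<mu> L \<alpha> \<delta> pl P l0 \<rho> =
    (\<Sum>out \<in> {Success, Loss}. prob_out pl out *\<^sub>R
      sandwich
        (block_diag P (block_diag (- \<rho>\<^sup>2 *\<^sub>R P) (l0 *\<^sub>R M_0 \<mu> L)))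
        (vcat (hcat (A_p \<delta> out) (B_pu \<alpha> \<delta> out))
        (vcat (hcat (mat 1)     0)
        (vcat (hcat c_x         0)
              (hcat 0           (mat 1))))))"

definition lmi_q :: "real \<Rightarrow> real \<Rightarrow> real \<Rightarrow> real \<Rightarrow> real \<Rightarrow> real \<Rightarrow> real \<Rightarrow> real \<Rightarrow> real^3^3 \<Rightarrow>
    real \<Rightarrow> real \<Rightarrow> real \<Rightarrow> real^(3 + 1 + 1)^(3 + 1 + 1)" where
  "lmi_q \<mu> L \<sigma> \<alpha> \<delta> \<zeta> \<eta> pl Q l0 l1 \<rho> =
    (\<Sum>out \<in> {Success, Loss}. prob_out pl out *\<^sub>R
      sandwich
        (block_diag Q (block_diag (- \<rho>\<^sup>2 *\<^sub>R Q) (block_diag (l0 *\<^sub>R M_0 \<mu> L) (l1 *\<^sub>R M_1 \<sigma>))))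
        (vcat (hcat (A_q \<delta> \<eta> out) (hcat (B_qu \<alpha> \<delta> out) (B_qv \<delta> \<zeta> \<eta> out)))
        (vcat (hcat (mat 1)       (hcat 0              0))
        (vcat (vcat (hcat c_x     (hcat 0              (mat (- 1))))
                    (hcat 0       (hcat (mat 1)        0)))
              (vcat (hcat c_y     (hcat 0              0))
                    (hcat 0       (hcat 0              (mat 1))))))))"

end

theory Submission
  imports Defs
begin

text \<open>The proof is a Lyapunov argument for a randomly switched system. Measured relative to a fixed
  point, the state is updated linearly, with the difference of the gradients as input. The
  projections \<open>avg_proj\<close> and \<open>mat 1 - avg_proj\<close> split it into the average over the agents, on which the Laplacian
  does not act, and the deviations from it, and \<open>T\<close> weighs the former by \<open>P\<close> and the latter by \<open>Q\<close>
  (\<open>qf_lyapunov\<close>). The two matrix inequalities bound the expected value of either part after one step by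
  \<open>\<rho>\<^sup>2\<close> times its present value, minus multiples of two quadratic forms: the sector form of the gradients and the
  form expressing that the Laplacian is \<open>\<sigma>\<close>-close to the identity on deviations. Since the sector
  multiplier is common to both inequalities, the sector forms of the average and of the deviations add up
  to those of the single agents, which are nonnegative. Hence the quadratic form of \<open>T\<close> drops by the
  factor \<open>\<rho>\<^sup>2\<close> in expectation over the next outcome (\<open>expected_lyapunov_decrease\<close>).

  The state at time \<open>k\<close> is a function of the outcomes up to time \<open>k\<close>, so the next outcome is
  independent of it and the decrease can be iterated (\<open>expectation_chain_Suc\<close>). Comparing the form with the
  norm costs the ratio of the extreme eigenvalues of \<open>T\<close>, that is, its condition number (\<open>pos_def_cond\<close>).
  The output error is a bounded linear image of the state error, and its geometrically decaying second moments
  are summable, which gives almost sure convergence.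

  The existence of a fixed point whose output is the optimizer has to be extracted from the hypotheses
  as well. Its equations can be solved when \<open>\<zeta>\<close> and \<open>\<eta>\<close> are nonzero (\<open>optimal_fixed_point\<close>), because \<open>\<sigma> < 1\<close> makes the
  Laplacian invertible on mean-zero vectors. If one of these parameters were zero, the deviation
  system would have a nonzero stationary state compatible with all constraints, which the inequality
  for \<open>Q\<close> excludes (\<open>no_unit_mode\<close>).\<close>

section \<open>Block matrices and quadratic forms\<close>

definition vjoin :: "real^'a \<Rightarrow> real^'b \<Rightarrow> real^('a::finite + 'b::finite)" where
  "vjoin x y = (\<chi> i. case i of Inl k \<Rightarrow> x $ k | Inr k \<Rightarrow> y $ k)"

lemma sum_Plus_UNIV:
  fixes g :: "'a::finite + 'b::finite \<Rightarrow> 'c::comm_monoid_add"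
  shows "(\<Sum>i\<in>UNIV. g i) = (\<Sum>i\<in>UNIV. g (Inl i)) + (\<Sum>i\<in>UNIV. g (Inr i))"
  by (subst UNIV_Plus_UNIV[symmetric], subst sum.Plus) simp_all

lemma inner_vjoin: "vjoin x y \<bullet> vjoin x' y' = x \<bullet> x' + y \<bullet> y'"
  by (simp add: inner_vec_def vjoin_def sum_Plus_UNIV)

lemma vcat_mult: "vcat A B *v x = vjoin (A *v x) (B *v x)"
  by (auto simp: vcat_def vjoin_def matrix_vector_mult_def vec_eq_iff split: sum.split)

lemma hcat_mult: "hcat A B *v vjoin x y = A *v x + B *v y"
  by (simp add: hcat_def vjoin_def matrix_vector_mult_def vec_eq_iff sum_Plus_UNIV)

lemma block_diag_mult: "block_diag A B *v vjoin x y = vjoin (A *v x) (B *v y)"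
  by (simp add: block_diag_def vcat_mult hcat_mult)

definition qf :: "real^'m^'m \<Rightarrow> real^'m \<Rightarrow> real" where
  "qf A x = x \<bullet> (A *v x)"

lemma qf_sandwich: "qf (sandwich A X) x = qf A (X *v x)"
proof -
  have "x \<bullet> (transpose X *v y) = (X *v x) \<bullet> y" for y
    using dot_lmul_matrix[of x "transpose X" y] by (simp add: transpose_matrix_vector flip: vector_transpose_matrix)
  then show ?thesis by (simp only: qf_def sandwich_def matrix_vector_mul_assoc[symmetric])
qed

lemma qf_block_diag: "qf (block_diag A B) (vjoin x y) = qf A x + qf B y"
  by (simp add: qf_def block_diag_mult inner_vjoin)

lemma qf_scaleR: "qf (c *\<^sub>R A) x = c * qf A x"
  by (simp add: qf_def scaleR_matrix_vector_assoc[symmetric])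

lemma qf_add: "qf (A + B) x = qf A x + qf B x"
  by (simp add: qf_def matrix_vector_mult_add_rdistrib inner_add_right)

section \<open>The matrix inequalities as dissipation inequalities\<close>

text \<open>The form equals \<open>2 (b - \<mu> a) (L a - b)\<close>: it is nonnegative exactly if \<open>b\<close> lies between \<open>\<mu> a\<close> and \<open>L a\<close>.\<close>

definition gradient_form :: "real \<Rightarrow> real \<Rightarrow> real \<Rightarrow> real \<Rightarrow> real" where
  "gradient_form \<mu> L a b = - 2 * \<mu> * L * a\<^sup>2 + 2 * (L + \<mu>) * a * b - 2 * b\<^sup>2"

text \<open>The form is \<open>(\<sigma> a)\<^sup>2 - (a - b)\<^sup>2\<close>. Summed over the agents, with \<open>b = lap a\<close>, it measures how far
  \<open>a - lap a\<close> stays below \<open>\<sigma>\<close> times the norm of \<open>a\<close>.\<close>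

definition laplacian_form :: "real \<Rightarrow> real \<Rightarrow> real \<Rightarrow> real" where
  "laplacian_form \<sigma> a b = (\<sigma>\<^sup>2 - 1) * a\<^sup>2 + 2 * a * b - b\<^sup>2"

lemma inner_real_1: "x \<bullet> y = x $ 1 * y $ 1" for x y :: "real^1"
  by (simp add: inner_vec_def)

lemma mat_mult: "mat c *v x = c *\<^sub>R x" for x :: "real^'m"
  by (simp add: vec_eq_iff matrix_vector_mult_def mat_def if_distrib[of "\<lambda>y. y * _"] cong: if_cong)

lemma qf_M_0: "qf (M_0 \<mu> L) (vjoin a b) = gradient_form \<mu> L (a $ 1) (b $ 1)"
  by (simp add: qf_def M_0_def vcat_mult hcat_mult inner_vjoin mat_mult inner_real_1
      gradient_form_def power2_eq_square algebra_simps)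

lemma qf_M_1: "qf (M_1 \<sigma>) (vjoin a b) = laplacian_form \<sigma> (a $ 1) (b $ 1)"
  by (simp add: qf_def M_1_def vcat_mult hcat_mult inner_vjoin mat_mult inner_real_1
      laplacian_form_def power2_eq_square algebra_simps)

lemma c_x_mult: "c_x *v e = vec (e $ 1)"
  by (simp add: vec_eq_iff c_x_def matrix_vector_mult_def sum_3 forall_1 vector_3 vector_1)

lemma c_y_mult: "c_y *v e = vec (e $ 3)"
  by (simp add: vec_eq_iff c_y_def matrix_vector_mult_def sum_3 forall_1 vector_3 vector_1)

lemma sum_outcomes: "(\<Sum>out\<in>{Success, Loss}. g out) = g Success + g Loss"
  by simp

text \<open>A matrix inequality is used only through its quadratic form. Evaluated at \<open>(e, u)\<close>, where \<open>e\<close> is the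
  average of the three error signals and \<open>u\<close> that of the gradient errors, it says that the
  expected storage after one step drops by the factor \<open>\<rho>\<^sup>2\<close> up to a multiple of the sector form. The
  average of \<open>v\<close> does not occur because it vanishes.\<close>

lemma lmi_p_dissipation:
  assumes "neg_semidef (lmi_p \<mu> L \<alpha> \<delta> pl P l0 \<rho>)"
  shows "(\<Sum>out\<in>{Success, Loss}. prob_out pl out * qf P (A_p \<delta> out *v e + B_pu \<alpha> \<delta> out *v vec u))
      + l0 * gradient_form \<mu> L (e $ 1) u \<le> \<rho>\<^sup>2 * qf P e"
proof -
  have "qf (lmi_p \<mu> L \<alpha> \<delta> pl P l0 \<rho>) (vjoin e (vec u)) \<le> 0"
    using assms by (simp add: neg_semidef_def qf_def)
  then show ?thesis
    unfolding lmi_p_def sum_outcomes qf_add qf_scaleR qf_sandwich vcat_mult hcat_mult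
      qf_block_diag qf_M_0 c_x_mult matrix_vector_mul_lid matrix_vector_mult_0 add_0_left add_0_right
      vec_component prob_out.simps
    by (simp add: algebra_simps del: A_p.simps B_pu.simps)
qed

text \<open>The counterpart for the deviation of one agent from the average. Here the Laplacian acts, so \<open>v\<close>
  enters as a second input next to the gradient error \<open>u\<close>.\<close>

lemma lmi_q_dissipation:
  assumes "neg_semidef (lmi_q \<mu> L \<sigma> \<alpha> \<delta> \<zeta> \<eta> pl Q l0 l1 \<rho>)"
  shows "(\<Sum>out\<in>{Success, Loss}. prob_out pl out *
        qf Q (A_q \<delta> \<eta> out *v e + B_qu \<alpha> \<delta> out *v vec u + B_qv \<delta> \<zeta> \<eta> out *v vec v))
      + l0 * gradient_form \<mu> L (e $ 1 - v) u + l1 * laplacian_form \<sigma> (e $ 3) v \<le> \<rho>\<^sup>2 * qf Q e"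
proof -
  have "qf (lmi_q \<mu> L \<sigma> \<alpha> \<delta> \<zeta> \<eta> pl Q l0 l1 \<rho>) (vjoin e (vjoin (vec u) (vec v))) \<le> 0"
    using assms by (simp add: neg_semidef_def qf_def)
  then show ?thesis
    unfolding lmi_q_def sum_outcomes qf_add qf_scaleR qf_sandwich vcat_mult hcat_mult
      qf_block_diag qf_M_0 qf_M_1 c_x_mult c_y_mult mat_mult matrix_vector_mul_lid
      matrix_vector_mult_0 add_0_left add_0_right vector_add_component vector_scaleR_component
      vec_component prob_out.simps
    by (simp add: algebra_simps del: A_q.simps B_qu.simps B_qv.simps)
qed

section \<open>Average and deviation\<close>

definition mean :: "real^'n \<Rightarrow> real" where
  "mean x = (\<Sum>i\<in>UNIV. x $ i) / real CARD('n)"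

definition dev :: "real^'n \<Rightarrow> 'n \<Rightarrow> real" where
  "dev x i = x $ i - mean x"

lemma avg_proj_mult: "(avg_proj *v x) $ i = mean x"
  by (simp add: avg_proj_def mean_def matrix_vector_mult_def sum_divide_distrib)

lemma avg_proj_compl_mult: "((mat 1 - avg_proj) *v x) $ i = dev x i"
  by (simp add: matrix_vector_mult_diff_rdistrib avg_proj_mult dev_def)

lemma sum_dev: "(\<Sum>i\<in>UNIV. dev x i) = 0"
  by (simp add: dev_def sum_subtractf) (simp add: mean_def)

lemma inner_avg_proj: "x \<bullet> (avg_proj *v y) = real CARD('n) * (mean x * mean y)"
  for x y :: "real^'n"
  by (simp add: inner_vec_def avg_proj_mult sum_distrib_right[symmetric] mean_def[of x])

lemma inner_avg_proj_compl: "x \<bullet> ((mat 1 - avg_proj) *v y) = (\<Sum>i\<in>UNIV. dev x i * dev y i)"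
  for x y :: "real^'n"
proof -
  have "x \<bullet> ((mat 1 - avg_proj) *v y) = (\<Sum>i\<in>UNIV. (dev x i + mean x) * dev y i)"
    by (simp add: inner_vec_def avg_proj_compl_mult dev_def[of x])
  also have "\<dots> = (\<Sum>i\<in>UNIV. dev x i * dev y i) + mean x * (\<Sum>i\<in>UNIV. dev y i)"
    by (simp add: distrib_right sum.distrib sum_distrib_left)
  finally show ?thesis by (simp add: sum_dev)
qed

text \<open>The orthogonal decomposition of \<open>\<real>\<^sup>n\<close> into the consensus line and its complement. Any quadratic
  constraint that holds agent by agent can be distributed over the average and the deviations by it.\<close>

lemma inner_mean_dev:
  "x \<bullet> y = real CARD('n) * (mean x * mean y) + (\<Sum>i\<in>UNIV. dev x i * dev y i)"
  for x y :: "real^'n"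
  using inner_avg_proj[of x y] inner_avg_proj_compl[of x y]
  by (simp add: matrix_vector_mult_diff_rdistrib inner_diff_right)

section \<open>The Kronecker Lyapunov matrix\<close>

text \<open>An index of the Kronecker product is a pair of a signal and an agent; a layer is one signal, read
  across all agents.\<close>

definition layer :: "'m \<Rightarrow> real^('m::finite \<times> 'n::finite) \<Rightarrow> real^'n" where
  "layer a z = (\<chi> i. z $ (a, i))"

lemma sum_Times_UNIV:
  fixes g :: "'a::finite \<times> 'b::finite \<Rightarrow> 'c::comm_monoid_add"
  shows "(\<Sum>p\<in>UNIV. g p) = (\<Sum>a\<in>UNIV. \<Sum>b\<in>UNIV. g (a, b))"
  by (subst UNIV_Times_UNIV[symmetric], subst sum.cartesian_product) simp

lemma qf_kron:
  fixes A :: "real^'m^'m" and B :: "real^'n^'n" and z :: "real^('m \<times> 'n)"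
  shows "qf (A \<otimes>\<^sub>K B) z = (\<Sum>a\<in>UNIV. \<Sum>b\<in>UNIV. A $ a $ b * (layer a z \<bullet> (B *v layer b z)))"
proof -
  have "qf (A \<otimes>\<^sub>K B) z = (\<Sum>a\<in>UNIV. \<Sum>i\<in>UNIV. \<Sum>b\<in>UNIV. \<Sum>j\<in>UNIV.
      A $ a $ b * (z $ (a, i) * (B $ i $ j * z $ (b, j))))"
    by (simp add: qf_def inner_vec_def matrix_vector_mult_def kron_def sum_distrib_left
        sum_Times_UNIV mult_ac)
  also have "\<dots> = (\<Sum>a\<in>UNIV. \<Sum>b\<in>UNIV. \<Sum>i\<in>UNIV. \<Sum>j\<in>UNIV.
      A $ a $ b * (z $ (a, i) * (B $ i $ j * z $ (b, j))))"
    by (intro sum.cong refl sum.swap)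
  finally show ?thesis
    by (simp add: inner_vec_def matrix_vector_mult_def layer_def sum_distrib_left)
qed

lemma qf_sum: "qf A x = (\<Sum>a\<in>UNIV. \<Sum>b\<in>UNIV. A $ a $ b * (x $ a * x $ b))"
  by (simp add: qf_def inner_vec_def matrix_vector_mult_def sum_distrib_left mult_ac)

text \<open>Since \<open>avg_proj\<close> and its complement are complementary orthogonal projections, \<open>P\<close> weighs the average of
  the signals and \<open>Q\<close> the deviations, without cross terms.\<close>

definition lyapunov :: "real^'m^'m \<Rightarrow> real^'m^'m \<Rightarrow> real^('m::finite \<times> 'n::finite)^('m \<times> 'n)" where
  "lyapunov P Q = P \<otimes>\<^sub>K avg_proj + Q \<otimes>\<^sub>K (mat 1 - avg_proj)"

lemma qf_lyapunov:
  fixes z :: "real^('m::finite \<times> 'n::finite)"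
  shows "qf (lyapunov P Q) z = real CARD('n) * qf P (\<chi> a. mean (layer a z)) +
      (\<Sum>i\<in>UNIV. qf Q (\<chi> a. dev (layer a z) i))"
proof -
  have "qf (Q \<otimes>\<^sub>K (mat 1 - avg_proj)) z =
      (\<Sum>a\<in>UNIV. \<Sum>b\<in>UNIV. \<Sum>i\<in>UNIV. Q $ a $ b * (dev (layer a z) i * dev (layer b z) i))"
    by (simp add: qf_kron inner_avg_proj_compl sum_distrib_left)
  also have "\<dots> = (\<Sum>a\<in>UNIV. \<Sum>i\<in>UNIV. \<Sum>b\<in>UNIV. Q $ a $ b * (dev (layer a z) i * dev (layer b z) i))"
    by (intro sum.cong refl sum.swap)
  also have "\<dots> = (\<Sum>i\<in>UNIV. qf Q (\<chi> a. dev (layer a z) i))"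
    by (subst sum.swap) (simp add: qf_sum)
  finally show ?thesis
    unfolding lyapunov_def qf_add
    by (simp add: qf_kron inner_avg_proj) (simp add: qf_sum sum_distrib_left mult_ac)
qed

text \<open>A vector is determined by its averages and deviations, so a nonzero one has a nonzero component that
  \<open>P\<close> or \<open>Q\<close> weighs positively.\<close>

lemma pos_def_lyapunov:
  fixes P Q :: "real^'m^'m"
  assumes "pos_def P" "pos_def Q"
  shows "pos_def (lyapunov P Q :: real^('m \<times> 'n::finite)^('m \<times> 'n))"
  unfolding pos_def_def
proof (intro conjI allI impI)
  have sym: "P $ a $ b = P $ b $ a" "Q $ a $ b = Q $ b $ a" for a b
    using assms unfolding pos_def_def by (metis transpose_def vec_lambda_beta)+
  show "transpose (lyapunov P Q) = (lyapunov P Q :: real^('m \<times> 'n)^('m \<times> 'n))"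
  proof -
    have "lyapunov P Q $ p $ q = (lyapunov P Q :: real^('m \<times> 'n)^('m \<times> 'n)) $ q $ p" for p q
      by (cases "snd p = snd q")
        (simp_all add: lyapunov_def kron_def avg_proj_def mat_def sym[of "fst p" "fst q"])
    then show ?thesis by (simp add: vec_eq_iff transpose_def)
  qed
next
  fix z :: "real^('m \<times> 'n)" assume z: "z \<noteq> 0"
  define p where "p = (\<chi> a. mean (layer a z))"
  define q where "q i = (\<chi> a. dev (layer a z) i)" for i
  have ge: "0 \<le> qf A x" if "pos_def A" for A :: "real^'m^'m" and x
    using that by (cases "x = 0") (auto simp: pos_def_def qf_def less_imp_le)
  have gt: "0 < qf A x" if "pos_def A" "x \<noteq> 0" for A :: "real^'m^'m" and x
    using that by (auto simp: pos_def_def qf_def)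
  have eq: "qf (lyapunov P Q) z = real CARD('n) * qf P p + (\<Sum>i\<in>UNIV. qf Q (q i))"
    by (simp add: qf_lyapunov p_def q_def)
  have "p \<noteq> 0 \<or> (\<exists>i. q i \<noteq> 0)"
  proof (rule ccontr)
    assume "\<not> ?thesis"
    then have "p $ a = 0" "q i $ a = 0" for a i by auto
    then have "mean (layer a z) = 0" "dev (layer a z) i = 0" for a i
      by (simp_all add: p_def q_def)
    then have "layer a z $ i = 0" for a i by (simp add: dev_def)
    then have "z $ (a, i) = 0" for a i by (simp add: layer_def)
    with z show False by (auto simp: vec_eq_iff)
  qed
  then have "0 < qf (lyapunov P Q) z"
  proof
    assume "p \<noteq> 0"
    then have "0 < real CARD('n) * qf P p" using gt assms by (auto simp: card_gt_0_iff)
    then show ?thesis unfolding eq by (intro add_pos_nonneg sum_nonneg ge assms)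
  next
    assume "\<exists>i. q i \<noteq> 0"
    then obtain i where "q i \<noteq> 0" by blast
    then have "0 < (\<Sum>i\<in>UNIV. qf Q (q i))"
      by (intro sum_pos2[of _ i] gt ge assms) auto
    then show ?thesis unfolding eq by (intro add_nonneg_pos mult_nonneg_nonneg ge assms) auto
  qed
  then show "0 < z \<bullet> (lyapunov P Q *v z)" by (simp add: qf_def)
qed

section \<open>Eigenvalue bounds\<close>

lemma symmetric_inner: "transpose A = A \<Longrightarrow> x \<bullet> (A *v y) = (A *v x) \<bullet> y"
  for A :: "real^'m^'m"
  by (metis dot_lmul_matrix vector_transpose_matrix)

text \<open>If \<open>y = A x\<close> were nonzero, the quadratic \<open>t \<mapsto> qf A (x + t y) = 2 t (y \<bullet> y) + t\<^sup>2 qf A y\<close> would have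
  nonzero slope at its zero \<open>t = 0\<close> and take negative values.\<close>

lemma psd_qf_zero_imp_kernel:
  fixes A :: "real^'m^'m"
  assumes sym: "transpose A = A" and psd: "\<And>x. 0 \<le> qf A x" and zero: "qf A x = 0"
  shows "A *v x = 0"
proof (rule ccontr)
  define y where "y = A *v x"
  assume "A *v x \<noteq> 0"
  then have y: "y \<bullet> y > 0" by (simp add: y_def)
  have "qf A (x + t *\<^sub>R y) = 2 * t * (y \<bullet> y) + t\<^sup>2 * qf A y" for t
    using zero symmetric_inner[OF sym, of x y]
    by (simp add: qf_def y_def matrix_vector_right_distrib matrix_vector_mult_scaleR inner_add_left
        inner_add_right power2_eq_square algebra_simps inner_commute)
  \<comment> \<open>The step minimizes the quadratic up to the summand 1, which keeps the denominator positive.\<close>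
  from psd[of "x + (- (y \<bullet> y) / (qf A y + 1)) *\<^sub>R y"] this[of "- (y \<bullet> y) / (qf A y + 1)"]
  have "0 \<le> 2 * (- (y \<bullet> y) / (qf A y + 1)) * (y \<bullet> y) + (- (y \<bullet> y) / (qf A y + 1))\<^sup>2 * qf A y" by simp
  also have "\<dots> = - (y \<bullet> y)\<^sup>2 * (qf A y + 2) / (qf A y + 1)\<^sup>2"
  proof -
    have "qf A y + 1 \<noteq> 0" using psd[of y] by linarith
    moreover have "2 * (- b / q) * b + (- b / q)\<^sup>2 * (q - 1) = - b\<^sup>2 * (q + 1) / q\<^sup>2" if "q \<noteq> 0" for b q :: real
      using that by (simp add: divide_simps) (simp add: power2_eq_square algebra_simps)
    from this[of "qf A y + 1" "y \<bullet> y"] show ?thesis using calculation by (simp add: add.assoc)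
  qed
  also have "\<dots> < 0" using psd[of y] y by (auto intro!: divide_neg_pos mult_neg_pos)
  finally show False by simp
qed

text \<open>The Rayleigh quotient attains its maximum \<open>c\<close> on the compact unit sphere. Then \<open>c I - A\<close> is positive
  semidefinite and its form vanishes at the maximizer, which is therefore an eigenvector.\<close>

lemma rayleigh_max_eigenval:
  fixes A :: "real^'m^'m"
  assumes sym: "transpose A = A"
  obtains c where "c \<in> eigenvals A" "\<And>x. qf A x \<le> c * (norm x)\<^sup>2"
proof -
  have "continuous_on (sphere 0 1) (qf A)"
    unfolding qf_def by (intro continuous_intros)
  then obtain x where x: "norm x = 1" and max: "\<And>y. norm y = 1 \<Longrightarrow> qf A y \<le> qf A x"
    using continuous_attains_sup[of "sphere (0 :: real^'m) 1" "qf A"] vector_choose_size[of 1]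
    by (auto simp del: sphere_def)
  define c where "c = qf A x"
  have le: "qf A y \<le> c * (norm y)\<^sup>2" for y
  proof (cases "y = 0")
    case False
    have "qf A y = (norm y)\<^sup>2 * qf A (y /\<^sub>R norm y)"
      using False by (simp add: qf_def matrix_vector_mult_scaleR power2_eq_square field_simps)
    then show ?thesis using max[of "y /\<^sub>R norm y"] False
      by (simp add: c_def mult.commute mult_left_mono)
  qed (simp add: qf_def)
  have mat: "qf (mat c - A) y = c * (norm y)\<^sup>2 - qf A y" for y
    by (simp add: qf_def matrix_vector_mult_diff_rdistrib inner_diff_right power2_norm_eq_inner
        mat_mult)
  have "(mat c - A) *v x = 0"
  proof (rule psd_qf_zero_imp_kernel)
    show "transpose (mat c - A) = mat c - A"
      using sym by (simp add: transpose_def mat_def vec_eq_iff)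
    show "0 \<le> qf (mat c - A) y" for y using le[of y] by (simp add: mat)
    show "qf (mat c - A) x = 0" by (simp add: mat x) (simp add: c_def)
  qed
  then have "A *v x = c *\<^sub>R x"
    by (simp add: matrix_vector_mult_diff_rdistrib mat_mult)
  with x have "c \<in> eigenvals A" by (auto simp: eigenvals_def intro!: exI[of _ x])
  with le show ?thesis using that by blast
qed

lemma eigenvals_uminus: "c \<in> eigenvals (- A) \<longleftrightarrow> - c \<in> eigenvals A"
  for A :: "real^'m^'m"
proof -
  have "- A *v v = - (A *v v)" for v
    by (simp add: vec_eq_iff matrix_vector_mult_def sum_negf)
  moreover have "- (A *v v) = c *\<^sub>R v \<longleftrightarrow> A *v v = (- c) *\<^sub>R v" for v
    by (subst neg_equal_iff_equal[symmetric]) simp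
  ultimately show ?thesis by (simp add: eigenvals_def)
qed

lemma rayleigh_min_eigenval:
  fixes A :: "real^'m^'m"
  assumes sym: "transpose A = A"
  obtains c where "c \<in> eigenvals A" "\<And>x. c * (norm x)\<^sup>2 \<le> qf A x"
proof -
  have "transpose (- A) = - A" using sym by (simp add: transpose_def vec_eq_iff)
  then obtain d where d: "d \<in> eigenvals (- A)" "\<And>x. qf (- A) x \<le> d * (norm x)\<^sup>2"
    using rayleigh_max_eigenval by blast
  have "qf (- A) x = - qf A x" for x
    by (simp add: qf_def inner_vec_def matrix_vector_mult_def sum_negf)
  moreover have "- d \<in> eigenvals A" using d(1) by (simp add: eigenvals_uminus)
  ultimately show ?thesis using d(2) by (intro that[of "- d"]) (auto simp: minus_le_iff)
qed

text \<open>Eigenvectors for different eigenvalues are orthogonal, hence independent, and there are only finitely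
  many independent vectors. This makes the maximum and minimum in \<open>cond\<close> meaningful.\<close>

lemma finite_eigenvals:
  fixes A :: "real^'m^'m"
  assumes sym: "transpose A = A"
  shows "finite (eigenvals A)"
proof -
  define v where "v c = (SOME v. v \<noteq> 0 \<and> A *v v = c *\<^sub>R v)" for c
  have v: "v c \<noteq> 0 \<and> A *v v c = c *\<^sub>R v c" if "c \<in> eigenvals A" for c
  proof -
    have "\<exists>v. v \<noteq> 0 \<and> A *v v = c *\<^sub>R v" using that by (simp add: eigenvals_def)
    from someI_ex[OF this] show ?thesis by (simp add: v_def)
  qed
  have orth: "v c \<bullet> v d = 0" if "c \<in> eigenvals A" "d \<in> eigenvals A" "c \<noteq> d" for c d
    using symmetric_inner[OF sym, of "v c" "v d"] v[OF that(1)] v[OF that(2)] that(3) by simp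
  have "inj_on v (eigenvals A)"
  proof (rule inj_onI, rule ccontr)
    fix c d assume cd: "c \<in> eigenvals A" "d \<in> eigenvals A" "v c = v d" "c \<noteq> d"
    with orth[of c d] v[of c] show False by simp
  qed
  moreover have "pairwise orthogonal (v ` eigenvals A)"
    using orth by (auto simp: pairwise_def orthogonal_def)
  then have "independent (v ` eigenvals A)"
    using v by (intro pairwise_orthogonal_independent) auto
  then have "finite (v ` eigenvals A)" by (rule independent_imp_finite)
  ultimately show ?thesis by (rule finite_imageD[rotated])
qed

text \<open>The form in which the condition number is used: the constant \<open>lo\<close> is the smallest eigenvalue, and
  \<open>cond A * lo\<close> is the largest.\<close>

lemma pos_def_cond:
  fixes A :: "real^'m^'m"
  assumes "pos_def A"
  obtains lo where "0 < lo" "\<And>x. lo * (norm x)\<^sup>2 \<le> qf A x" "\<And>x. qf A x \<le> cond A * lo * (norm x)\<^sup>2"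
proof -
  have sym: "transpose A = A" using assms by (simp add: pos_def_def)
  note fin = finite_eigenvals[OF sym]
  obtain hi where hi: "hi \<in> eigenvals A" "\<And>x. qf A x \<le> hi * (norm x)\<^sup>2"
    using rayleigh_max_eigenval[OF sym] by blast
  obtain lo where lo: "lo \<in> eigenvals A" "\<And>x. lo * (norm x)\<^sup>2 \<le> qf A x"
    using rayleigh_min_eigenval[OF sym] by blast
  have Ray: "\<exists>v. v \<noteq> 0 \<and> qf A v = c * (norm v)\<^sup>2" if "c \<in> eigenvals A" for c
    using that by (auto simp: eigenvals_def qf_def power2_norm_eq_inner)
  have "c \<le> hi \<and> lo \<le> c" if c: "c \<in> eigenvals A" for c
  proof -
    obtain v where "v \<noteq> 0" "qf A v = c * (norm v)\<^sup>2" using Ray[OF c] by blast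
    with hi(2)[of v] lo(2)[of v] show ?thesis by simp
  qed
  then have "Max (eigenvals A) = hi" "Min (eigenvals A) = lo"
    using fin hi(1) lo(1) by (auto intro!: Max_eqI Min_eqI)
  moreover have "0 < lo"
  proof -
    obtain v where "v \<noteq> 0" "qf A v = lo * (norm v)\<^sup>2" using Ray[OF lo(1)] by blast
    with assms show ?thesis by (auto simp: pos_def_def qf_def zero_less_mult_iff)
  qed
  ultimately show ?thesis using that[of lo] lo hi by (simp add: cond_def)
qed

section \<open>Decrease along one step of the error dynamics\<close>

text \<open>The three signals as one vector indexed by signal and agent, the argument of the Kronecker product.\<close>

fun stack :: "'n::finite state \<Rightarrow> real^(3 \<times> 'n)" where
  "stack (w1, w2, r) = (\<chi> p. (vector [w1, w2, r] :: real^'n^3) $ fst p $ snd p)"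

lemma layer_stack:
  "layer 1 (stack (w1, w2, r)) = w1"
  "layer 2 (stack (w1, w2, r)) = w2"
  "layer 3 (stack (w1, w2, r)) = r"
  by (simp_all add: layer_def vec_eq_iff vector_3)

lemma norm_stack: "norm (stack \<xi>) = norm \<xi>"
proof (cases \<xi>)
  case (fields w1 w2 r)
  have "stack \<xi> \<bullet> stack \<xi> = \<xi> \<bullet> \<xi>"
    by (simp add: fields inner_vec_def sum_Times_UNIV sum_3 vector_3)
  then show ?thesis by (simp add: norm_eq_sqrt_inner)
qed

fun mean_state :: "'n::finite state \<Rightarrow> real^3" where
  "mean_state (w1, w2, r) = vector [mean w1, mean w2, mean r]"

fun dev_state :: "'n::finite state \<Rightarrow> 'n \<Rightarrow> real^3" where
  "dev_state (w1, w2, r) i = vector [dev w1 i, dev w2 i, dev r i]"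

lemma qf_lyapunov_stack:
  "qf (lyapunov P Q) (stack \<xi>) =
    real CARD('n) * qf P (mean_state \<xi>) + (\<Sum>i\<in>UNIV. qf Q (dev_state \<xi> i))"
  for \<xi> :: "'n::finite state"
proof (cases \<xi>)
  case (fields w1 w2 r)
  have "(\<chi> a. mean (layer a (stack \<xi>))) = mean_state \<xi>"
    "(\<chi> a. dev (layer a (stack \<xi>)) i) = dev_state \<xi> i" for i
    unfolding fields mean_state.simps dev_state.simps vec_eq_iff forall_3
    by (simp_all add: layer_stack vector_3 del: stack.simps)
  then show ?thesis by (simp add: qf_lyapunov)
qed

lemma mean_linear:
  "mean (x + y) = mean x + mean y" "mean (x - y) = mean x - mean y"
  "mean (c *\<^sub>R x) = c * mean x"
  by (simp_all add: mean_def sum.distrib sum_subtractf add_divide_distrib diff_divide_distrib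
      sum_distrib_left)

lemma dev_linear:
  "dev (x + y) i = dev x i + dev y i" "dev (x - y) i = dev x i - dev y i"
  "dev (c *\<^sub>R x) i = c * dev x i"
  by (simp_all add: dev_def mean_linear algebra_simps)

lemma mean_avg_proj_compl: "mean ((mat 1 - avg_proj) *v x) = 0"
  by (simp add: mean_def avg_proj_compl_mult sum_dev)

lemma mean_avg_proj: "mean (avg_proj *v x) = mean x"
  by (simp add: mean_def[of "_ *v _"] avg_proj_mult)

lemma dev_avg_proj: "dev (avg_proj *v x) i = 0"
  by (simp add: dev_def mean_avg_proj avg_proj_mult)

text \<open>The update with the gradient \<open>u\<close> as a free input. It is jointly linear in input and state, so the error
  with respect to a fixed point obeys the same update, driven by the error of the gradients.\<close>

fun linear_step :: "real^'n^'n \<Rightarrow> real \<Rightarrow> real \<Rightarrow> real \<Rightarrow> real \<Rightarrow>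
    outcome \<Rightarrow> real^'n \<Rightarrow> 'n::finite state \<Rightarrow> 'n state" where
  "linear_step lap \<alpha> \<delta> \<zeta> \<eta> out u (w1, w2, r) =
    (let v = lap *v r;
         w1' = w1 - \<alpha> *\<^sub>R u - \<zeta> *\<^sub>R v;
         w2' = (mat 1 - avg_proj) *v (w1 + w2 - v)
     in (w1', w2', case out of Success \<Rightarrow> \<delta> *\<^sub>R w1' + \<eta> *\<^sub>R w2' | Loss \<Rightarrow> r))"

lemma step_eq_linear_step:
  "step f lap \<alpha> \<delta> \<zeta> \<eta> out \<xi> = linear_step lap \<alpha> \<delta> \<zeta> \<eta> out (gradF f (x_out lap \<xi>)) \<xi>"
  by (cases \<xi>) (simp add: Let_def)

lemma linear_step_diff:
  "linear_step lap \<alpha> \<delta> \<zeta> \<eta> out u \<xi> - linear_step lap \<alpha> \<delta> \<zeta> \<eta> out u' \<xi>' =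
    linear_step lap \<alpha> \<delta> \<zeta> \<eta> out (u - u') (\<xi> - \<xi>')"
  by (cases \<xi>; cases \<xi>'; cases out)
    (simp_all add: Let_def matrix_vector_mult_diff_distrib matrix_vector_right_distrib algebra_simps)

lemma mult_vec_3: "(A *v x) $ i = A $ i $ 1 * x $ 1 + A $ i $ 2 * x $ 2 + A $ i $ 3 * x $ 3"
  for A :: "real^3^'m"
  by (simp add: matrix_vector_mult_def sum_3)

lemma mult_vec_1: "(A *v x) $ i = A $ i $ 1 * x $ 1" for A :: "real^1^'m"
  by (simp add: matrix_vector_mult_def)

text \<open>The projections commute with the update, which splits into the average system below, on which the
  Laplacian does not act, and one copy per agent of the deviation system.\<close>

lemma mean_linear_step:
  assumes "\<And>r. mean (lap *v r) = 0"
  shows "mean_state (linear_step lap \<alpha> \<delta> \<zeta> \<eta> out u \<xi>) =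
    A_p \<delta> out *v mean_state \<xi> + B_pu \<alpha> \<delta> out *v vec (mean u)"
  by (cases \<xi>; cases out)
    (simp_all add: Let_def mean_linear mean_avg_proj assms vec_eq_iff[where 'b=3] forall_3 vector_3 vector_1
      mult_vec_3 mult_vec_1 algebra_simps)

lemma dev_linear_step:
  "dev_state (linear_step lap \<alpha> \<delta> \<zeta> \<eta> out u \<xi>) i =
    A_q \<delta> \<eta> out *v dev_state \<xi> i + B_qu \<alpha> \<delta> out *v vec (dev u i)
      + B_qv \<delta> \<zeta> \<eta> out *v vec (dev (lap *v snd (snd \<xi>)) i)"
  by (cases \<xi>; cases out)
    (simp_all add: Let_def dev_linear dev_avg_proj vec_eq_iff[where 'b=3] forall_3 vector_3 vector_1
      mult_vec_3 mult_vec_1 algebra_simps)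

lemma gradient_form_mean_dev:
  fixes x u :: "real^'n"
  shows "real CARD('n) * gradient_form \<mu> L (mean x) (mean u) +
      (\<Sum>i\<in>UNIV. gradient_form \<mu> L (dev x i) (dev u i)) =
    (\<Sum>i\<in>UNIV. gradient_form \<mu> L (x $ i) (u $ i))"
proof -
  have s: "(\<Sum>i\<in>UNIV. gradient_form \<mu> L (a i) (b i)) = - 2 * \<mu> * L * (\<Sum>i\<in>UNIV. a i * a i)
      + 2 * (L + \<mu>) * (\<Sum>i\<in>UNIV. a i * b i) - 2 * (\<Sum>i\<in>UNIV. b i * b i)" for a b :: "'n \<Rightarrow> real"
  proof -
    have "gradient_form \<mu> L (a i) (b i) = (- 2 * \<mu> * L) * (a i * a i) + (2 * (L + \<mu>)) * (a i * b i)
        - 2 * (b i * b i)" for i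
      by (simp add: gradient_form_def power2_eq_square)
    then show ?thesis by (simp only: sum.distrib sum_subtractf sum_distrib_left)
  qed
  have i: "(\<Sum>i\<in>UNIV. x $ i * y $ i) =
      real CARD('n) * (mean x * mean y) + (\<Sum>i\<in>UNIV. dev x i * dev y i)" for x y :: "real^'n"
    using inner_mean_dev[of x y] by (simp add: inner_vec_def)
  show ?thesis unfolding s i by (simp add: gradient_form_def power2_eq_square algebra_simps)
qed

text \<open>Because the Laplacian annihilates constants, \<open>lap r\<close> depends only on the deviation \<open>y\<close> of \<open>r\<close>, and
  \<open>y - lap r\<close> is the image of \<open>y\<close> under the matrix whose norm is \<open>\<sigma>\<close>. The claim is then
  \<open>\<parallel>y - lap r\<parallel> \<le> \<sigma> \<parallel>y\<parallel>\<close>, squared and summed over the agents.\<close>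

lemma laplacian_form_dev_nonneg:
  fixes lap :: "real^'n^'n"
  assumes ones: "lap *v 1 = 0" and mean0: "\<And>r. mean (lap *v r) = 0"
  assumes \<sigma>: "\<sigma> = spectral_norm (mat 1 - avg_proj - lap)"
  shows "0 \<le> (\<Sum>i\<in>UNIV. laplacian_form \<sigma> (dev r i) (dev (lap *v r) i))"
proof -
  define y where "y = (mat 1 - avg_proj) *v r"
  have avg: "avg_proj *v x = mean x *\<^sub>R 1" for x :: "real^'n"
    by (simp add: vec_eq_iff avg_proj_mult)
  have y: "y $ i = dev r i" for i by (simp add: y_def avg_proj_compl_mult)
  have "lap *v y = lap *v r"
    by (simp add: y_def matrix_vector_mult_diff_rdistrib matrix_vector_mult_diff_distrib avg
        matrix_vector_mult_scaleR ones)
  then have "(mat 1 - avg_proj - lap) *v y = y - lap *v r"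
    by (simp add: matrix_vector_mult_diff_rdistrib avg mean_avg_proj_compl[of r, folded y_def])
  then have "norm (y - lap *v r) \<le> \<sigma> * norm y"
    using onorm[OF matrix_vector_mul_bounded_linear, of "mat 1 - avg_proj - lap" y]
    by (simp add: \<sigma> spectral_norm_def)
  then have "(norm (y - lap *v r))\<^sup>2 \<le> (\<sigma> * norm y)\<^sup>2" by (intro power_mono) auto
  then have "(\<Sum>i\<in>UNIV. (dev r i - (lap *v r) $ i)\<^sup>2) \<le> \<sigma>\<^sup>2 * (\<Sum>i\<in>UNIV. (dev r i)\<^sup>2)"
    unfolding power2_norm_eq_inner power_mult_distrib
    by (simp add: inner_vec_def y power2_eq_square)
  then have "0 \<le> (\<Sum>i\<in>UNIV. \<sigma>\<^sup>2 * (dev r i)\<^sup>2 - (dev r i - (lap *v r) $ i)\<^sup>2)"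
    by (simp add: sum_subtractf sum_distrib_left)
  also have "\<dots> = (\<Sum>i\<in>UNIV. laplacian_form \<sigma> (dev r i) (dev (lap *v r) i))"
    by (intro sum.cong)
      (auto simp: laplacian_form_def dev_def[of "_ *v _"] mean0 power2_eq_square algebra_simps)
  finally show ?thesis .
qed

text \<open>One copy of the inequality for \<open>P\<close>, multiplied by the number of agents, and one copy of the inequality for
  \<open>Q\<close> per agent are added. Both carry the same multiplier \<open>l0\<close>, so the sector terms of the average and of the
  deviations recombine into a sum of the sector forms of the individual agents, which are
  nonnegative.\<close>

lemma expected_lyapunov_decrease:
  fixes lap :: "real^'n^'n"
  assumes lmi_P: "neg_semidef (lmi_p \<mu> L \<alpha> \<delta> pl P l0 \<rho>)"
    and lmi_Q: "neg_semidef (lmi_q \<mu> L \<sigma> \<alpha> \<delta> \<zeta> \<eta> pl Q l0 l1 \<rho>)"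
    and lambda: "l0 \<ge> 0" "l1 \<ge> 0"
    and ones: "lap *v 1 = 0" and mean0: "\<And>r. mean (lap *v r) = 0"
    and \<sigma>: "\<sigma> = spectral_norm (mat 1 - avg_proj - lap)"
    and sector: "\<And>i. 0 \<le> gradient_form \<mu> L (x_out lap \<xi> $ i) (u $ i)"
  shows "(\<Sum>out\<in>{Success, Loss}. prob_out pl out *
      qf (lyapunov P Q) (stack (linear_step lap \<alpha> \<delta> \<zeta> \<eta> out u \<xi>)))
    \<le> \<rho>\<^sup>2 * qf (lyapunov P Q) (stack \<xi>)"
proof (cases \<xi>)
  case (fields w1 w2 r)
  define p where "p out = prob_out pl out" for out
  define n where "n = real CARD('n)"
  define x where "x = x_out lap \<xi>"
  define v where "v = lap *v r"
  define mp where "mp out = qf P (mean_state (linear_step lap \<alpha> \<delta> \<zeta> \<eta> out u \<xi>))" for out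
  define dq where "dq out i = qf Q (dev_state (linear_step lap \<alpha> \<delta> \<zeta> \<eta> out u \<xi>) i)" for out i
  have m: "p Success * mp Success + p Loss * mp Loss + l0 * gradient_form \<mu> L (mean x) (mean u)
      \<le> \<rho>\<^sup>2 * qf P (mean_state \<xi>)"
    using lmi_p_dissipation[OF lmi_P, of "mean_state \<xi>" "mean u"]
    by (simp add: mp_def p_def mean_linear_step[OF mean0] x_def fields mean_linear mean0 vector_3
        del: A_p.simps B_pu.simps prob_out.simps linear_step.simps)
  have d: "p Success * dq Success i + p Loss * dq Loss i + l0 * gradient_form \<mu> L (dev x i) (dev u i)
      + l1 * laplacian_form \<sigma> (dev r i) (dev v i) \<le> \<rho>\<^sup>2 * qf Q (dev_state \<xi> i)" for i
    using lmi_q_dissipation[OF lmi_Q, of "dev_state \<xi> i" "dev u i" "dev v i"]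
    by (simp add: dq_def p_def dev_linear_step x_def v_def fields dev_linear vector_3
        del: A_q.simps B_qu.simps B_qv.simps prob_out.simps linear_step.simps)
  have "n * (p Success * mp Success + p Loss * mp Loss + l0 * gradient_form \<mu> L (mean x) (mean u))
      + (\<Sum>i\<in>UNIV. p Success * dq Success i + p Loss * dq Loss i
          + l0 * gradient_form \<mu> L (dev x i) (dev u i) + l1 * laplacian_form \<sigma> (dev r i) (dev v i))
      \<le> n * (\<rho>\<^sup>2 * qf P (mean_state \<xi>)) + (\<Sum>i\<in>UNIV. \<rho>\<^sup>2 * qf Q (dev_state \<xi> i))"
    by (intro add_mono mult_left_mono sum_mono m d) (simp add: n_def)
  then have "p Success * (n * mp Success + (\<Sum>i\<in>UNIV. dq Success i))
      + p Loss * (n * mp Loss + (\<Sum>i\<in>UNIV. dq Loss i))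
      + l0 * (n * gradient_form \<mu> L (mean x) (mean u) + (\<Sum>i\<in>UNIV. gradient_form \<mu> L (dev x i) (dev u i)))
      + l1 * (\<Sum>i\<in>UNIV. laplacian_form \<sigma> (dev r i) (dev v i))
      \<le> \<rho>\<^sup>2 * (n * qf P (mean_state \<xi>) + (\<Sum>i\<in>UNIV. qf Q (dev_state \<xi> i)))"
    unfolding sum.distrib sum_distrib_left[symmetric] by (simp add: algebra_simps)
  moreover have "0 \<le> l0 * (n * gradient_form \<mu> L (mean x) (mean u) +
      (\<Sum>i\<in>UNIV. gradient_form \<mu> L (dev x i) (dev u i)))"
    unfolding n_def gradient_form_mean_dev
    by (intro mult_nonneg_nonneg lambda sum_nonneg) (simp add: sector x_def)
  moreover have "0 \<le> l1 * (\<Sum>i\<in>UNIV. laplacian_form \<sigma> (dev r i) (dev v i))"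
    unfolding v_def by (intro mult_nonneg_nonneg lambda laplacian_form_dev_nonneg ones mean0 \<sigma>)
  ultimately show ?thesis
    by (simp add: qf_lyapunov_stack mp_def dq_def p_def n_def
        del: prob_out.simps linear_step.simps)
qed

section \<open>The fixed point\<close>

lemma mean_lap_zero:
  assumes "vec 1 v* lap = 0"
  shows "mean (lap *v r) = 0"
proof -
  have "(vec 1 v* lap) \<bullet> r = vec 1 \<bullet> (lap *v r)" by (rule dot_lmul_matrix)
  then show ?thesis using assms by (simp add: mean_def inner_vec_def)
qed

lemma laplacian_mult_one: "laplacian G wt *v 1 = 0"
proof -
  have "(\<Sum>j\<in>UNIV. laplacian G wt $ i $ j) = 0" for i
  proof -
    let ?N = "{k. k \<noteq> i \<and> (i, k) \<in> parcs G}"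
    have "(\<Sum>j\<in>UNIV. laplacian G wt $ i $ j) =
        laplacian G wt $ i $ i + (\<Sum>j\<in>UNIV - {i}. laplacian G wt $ i $ j)"
      by (rule sum.remove) auto
    also have "(\<Sum>j\<in>UNIV - {i}. laplacian G wt $ i $ j) = (\<Sum>j\<in>?N. - wt i j)"
      by (rule sum.mono_neutral_cong_right) (auto simp: laplacian_def)
    finally show ?thesis by (simp add: laplacian_def sum_negf)
  qed
  then show ?thesis by (simp add: vec_eq_iff matrix_vector_mult_def)
qed

text \<open>A state \<open>e\<close> that both outcomes leave unchanged, for zero gradient and an admissible Laplacian output \<open>v\<close>,
  would keep its storage \<open>qf Q e\<close> forever, whereas the inequality makes the storage shrink by \<open>\<rho>\<^sup>2 < 1\<close>.\<close>

lemma no_unit_mode: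
  assumes Q: "pos_def Q" and lmi: "neg_semidef (lmi_q \<mu> L \<sigma> \<alpha> \<delta> \<zeta> \<eta> pl Q l0 l1 \<rho>)"
    and l1: "0 \<le> l1" and rho: "\<rho> \<in> {0<..<1}"
    and steady: "\<And>out. A_q \<delta> \<eta> out *v e + B_qv \<delta> \<zeta> \<eta> out *v vec v = e"
    and x: "e $ 1 = v" and y: "0 \<le> laplacian_form \<sigma> (e $ 3) v"
  shows "e = 0"
proof (rule ccontr)
  assume "e \<noteq> 0"
  then have pos: "0 < qf Q e" using Q by (simp add: pos_def_def qf_def)
  have "qf Q e + l1 * laplacian_form \<sigma> (e $ 3) v \<le> \<rho>\<^sup>2 * qf Q e"
    using lmi_q_dissipation[OF lmi, of e 0 v] x
    by (simp add: steady gradient_form_def algebra_simps matrix_vector_mult_0_right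
        del: A_q.simps B_qu.simps B_qv.simps)
  moreover have "0 \<le> l1 * laplacian_form \<sigma> (e $ 3) v" using l1 y by simp
  moreover have "\<rho>\<^sup>2 * qf Q e < 1 * qf Q e"
    using pos rho by (intro mult_strict_right_mono) (auto simp: power_less_one_iff abs_square_less_1)
  ultimately show False by simp
qed

text \<open>With \<open>\<eta> = 0\<close> the second signal is never transmitted, so a constant disagreement in it persists.\<close>

lemma lmi_q_imp_eta_nonzero:
  assumes Q: "pos_def Q" and lmi: "neg_semidef (lmi_q \<mu> L \<sigma> \<alpha> \<delta> \<zeta> \<eta> pl Q l0 l1 \<rho>)"
    and l1: "0 \<le> l1" and rho: "\<rho> \<in> {0<..<1}"
  shows "\<eta> \<noteq> 0"
proof
  assume eta: "\<eta> = 0"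
  have "(vector [0, 1, 0] :: real^3) = 0"
  proof (rule no_unit_mode[OF Q lmi l1 rho, where v = 0])
    fix out
    show "A_q \<delta> \<eta> out *v vector [0, 1, 0] + B_qv \<delta> \<zeta> \<eta> out *v vec 0 = vector [0, 1, 0]"
      by (cases out) (simp_all add: eta vec_eq_iff forall_3 vector_3 matrix_vector_mult_def sum_3)
  qed (simp_all add: vector_3 laplacian_form_def)
  then show False by (simp add: vec_eq_iff forall_3 vector_3)
qed

text \<open>With \<open>\<zeta> = 0\<close> the first signal is not corrected by the Laplacian output, so it can persist while \<open>v\<close>
  cancels it in the output \<open>w\<^sub>1 - v\<close>; the second signal is chosen such that the memory repeats itself.\<close>

lemma lmi_q_imp_zeta_nonzero:
  assumes Q: "pos_def Q" and lmi: "neg_semidef (lmi_q \<mu> L \<sigma> \<alpha> \<delta> \<zeta> \<eta> pl Q l0 l1 \<rho>)"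
    and l1: "0 \<le> l1" and rho: "\<rho> \<in> {0<..<1}"
  shows "\<zeta> \<noteq> 0"
proof
  assume zeta: "\<zeta> = 0"
  have eta: "\<eta> \<noteq> 0" by (rule lmi_q_imp_eta_nonzero[OF assms])
  let ?e = "vector [1, (1 - \<delta>) / \<eta>, 1] :: real^3"
  have "?e = 0"
  proof (rule no_unit_mode[OF Q lmi l1 rho, where v = 1])
    fix out
    show "A_q \<delta> \<eta> out *v ?e + B_qv \<delta> \<zeta> \<eta> out *v vec 1 = ?e"
      using eta by (cases out)
        (simp_all add: zeta vec_eq_iff forall_3 vector_3 vector_1 matrix_vector_mult_def sum_3)
  qed (simp_all add: vector_3 laplacian_form_def)
  then show False by (simp add: vec_eq_iff forall_3 vector_3)
qed

text \<open>On the complement of the consensus line, \<open>lap\<close> differs from the identity by a contraction. Adding \<open>avg_proj\<close>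
  makes it invertible everywhere, and averaging shows that the preimage of a mean-zero vector has
  mean zero.\<close>

lemma laplacian_preimage:
  fixes lap :: "real^'n^'n"
  assumes mean0: "\<And>r. mean (lap *v r) = 0"
    and contr: "spectral_norm (mat 1 - avg_proj - lap) < 1" and v: "mean v = 0"
  obtains r where "mean r = 0" "lap *v r = v"
proof -
  let ?A = "avg_proj + lap"
  have "inj ((*v) ?A)"
  proof (rule linear_injective_0[THEN iffD2, rule_format])
    fix x assume x: "?A *v x = 0"
    have "(mat 1 - avg_proj - lap) *v x = x - ?A *v x"
      by (simp add: matrix_vector_mult_diff_rdistrib matrix_vector_mult_add_rdistrib)
    then have "norm x \<le> spectral_norm (mat 1 - avg_proj - lap) * norm x"
      using onorm[OF matrix_vector_mul_bounded_linear, of "mat 1 - avg_proj - lap" x] x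
      by (simp add: spectral_norm_def)
    with contr show "x = 0"
      by (smt (verit) mult_le_cancel_right1 norm_le_zero_iff)
  qed simp
  then have "surj ((*v) ?A)" by (intro linear_injective_imp_surjective) auto
  then obtain r where r: "v = ?A *v r" by (metis surjD)
  have "mean r = mean (?A *v r)"
    by (simp add: matrix_vector_mult_add_rdistrib mean_linear mean_avg_proj mean0)
  then have "mean r = 0" using r v by simp
  moreover from this have "avg_proj *v r = 0" by (simp add: vec_eq_iff avg_proj_mult)
  then have "lap *v r = v" by (simp add: r matrix_vector_mult_add_rdistrib)
  ultimately show ?thesis by (rule that)
qed

text \<open>Stationarity of the first signal requires \<open>\<zeta> v = - \<alpha> u\<close>, where \<open>u\<close> collects the local gradients at the
  optimizer. Optimality means that \<open>u\<close> has mean zero, so such a \<open>v\<close> is in the range of the Laplacian;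
  the second signal then absorbs the difference between the required memory and \<open>\<delta> w\<^sub>1\<close>. This is
  where \<open>\<zeta>\<close> and \<open>\<eta>\<close> have to be nonzero.\<close>

lemma optimal_fixed_point:
  fixes lap :: "real^'n^'n" and f :: "'n \<Rightarrow> real \<Rightarrow> real"
  assumes ones: "lap *v 1 = 0" and mean0: "\<And>r. mean (lap *v r) = 0"
    and contr: "spectral_norm (mat 1 - avg_proj - lap) < 1"
    and opt: "(\<Sum>i\<in>UNIV. deriv (f i) x_opt) = 0"
    and nz: "\<zeta> \<noteq> 0" "\<eta> \<noteq> 0"
  obtains w1 w2 r y u v where "is_fixed_point f lap \<alpha> \<delta> \<zeta> \<eta> w1 w2 r (vec x_opt) y u v"
proof -
  define u where "u = gradF f (vec x_opt)"
  define v where "v = (- \<alpha> / \<zeta>) *\<^sub>R u"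
  have "mean u = 0" by (simp add: mean_def u_def gradF_def opt)
  then have v0: "mean v = 0" unfolding v_def mean_linear by simp
  obtain r0 where r0: "mean r0 = 0" "lap *v r0 = v"
    using laplacian_preimage[OF mean0 contr v0] .
  define w1 where "w1 = vec x_opt + v"
  \<comment> \<open>Solving \<open>r0 = \<delta> w1 + \<eta> w2\<close> for \<open>w2\<close> would leave the mean of \<open>- (\<delta> / \<eta>) w1\<close> in \<open>w2\<close>, whose mean must be zero.
    That constant is left to \<open>r\<close> instead, where the Laplacian annihilates it.\<close>
  define w2 where "w2 = (1 / \<eta>) *\<^sub>R (r0 - \<delta> *\<^sub>R v)"
  define r where "r = \<delta> *\<^sub>R w1 + \<eta> *\<^sub>R w2"
  have one: "vec x_opt = x_opt *\<^sub>R (1 :: real^'n)" by (simp add: vec_eq_iff)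
  have "mean (1 :: real^'n) = 1" by (simp add: mean_def)
  then have dev1: "dev (1 :: real^'n) i = 0" for i by (simp add: dev_def)
  have "mean w2 = 0" by (simp add: w2_def mean_linear r0 v0)
  then have "(mat 1 - avg_proj) *v (w1 + w2 - v) = w2"
    by (simp add: vec_eq_iff avg_proj_compl_mult w1_def one dev_linear dev1) (simp add: dev_def)
  moreover have "r = r0 + (\<delta> * x_opt) *\<^sub>R 1"
    using nz by (simp add: r_def w2_def w1_def one algebra_simps)
  then have "lap *v r = v"
    by (simp add: matrix_vector_right_distrib matrix_vector_mult_scaleR r0 ones)
  ultimately have "is_fixed_point f lap \<alpha> \<delta> \<zeta> \<eta> w1 w2 r (vec x_opt) r u v"
    using nz by (simp add: is_fixed_point_def r_def u_def[symmetric] w1_def v_def)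
  then show ?thesis by (rule that)
qed

lemma step_fixed_point:
  assumes "is_fixed_point f lap \<alpha> \<delta> \<zeta> \<eta> w1 w2 r x y u v"
  shows "step f lap \<alpha> \<delta> \<zeta> \<eta> out (w1, w2, r) = (w1, w2, r)"
proof -
  have fp: "w1 = w1 - \<alpha> *\<^sub>R u - \<zeta> *\<^sub>R v" "w2 = (mat 1 - avg_proj) *v (w1 + w2 - v)"
    "r = \<delta> *\<^sub>R w1 + \<eta> *\<^sub>R w2" "u = gradF f (w1 - v)" "v = lap *v r"
    using assms by (auto simp: is_fixed_point_def)
  have "step f lap \<alpha> \<delta> \<zeta> \<eta> out (w1, w2, r) =
      (w1 - \<alpha> *\<^sub>R u - \<zeta> *\<^sub>R v, (mat 1 - avg_proj) *v (w1 + w2 - v),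
       case out of Success \<Rightarrow> \<delta> *\<^sub>R (w1 - \<alpha> *\<^sub>R u - \<zeta> *\<^sub>R v)
         + \<eta> *\<^sub>R ((mat 1 - avg_proj) *v (w1 + w2 - v)) | Loss \<Rightarrow> r)"
    by (simp only: step.simps Let_def fp(4) fp(5)[symmetric])
  then show ?thesis
    unfolding fp(1)[symmetric] fp(2)[symmetric] by (cases out) (simp_all only: outcome.case fp(3)[symmetric])
qed

section \<open>Expectations along a randomly switched recursion\<close>

context prob_space
begin

lemma integrable_simple_function:
  fixes h :: "'a \<Rightarrow> real"
  assumes "simple_function M h"
  shows "integrable M h"
  using assms by (intro integrableI_simple_bochner_integrable simple_bochner_integrable.intros)
    (simp_all add: emeasure_eq_measure)

context
  fixes net :: "nat \<Rightarrow> 'a \<Rightarrow> outcome" and g :: "outcome \<Rightarrow> 's \<Rightarrow> 's" and X :: "nat \<Rightarrow> 'a \<Rightarrow> 's" and s0 :: 's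
  assumes indep: "indep_vars (\<lambda>_. count_space UNIV) net UNIV"
    and X_0: "\<And>\<omega>. X 0 \<omega> = s0"
    and X_Suc: "\<And>k \<omega>. X (Suc k) \<omega> = g (net (Suc k) \<omega>) (X k \<omega>)"
begin

lemma simple_function_net: "simple_function M (net k)"
proof -
  have "net k \<in> measurable M (count_space UNIV)"
    using indep by (simp add: indep_vars_def)
  moreover have "finite (net k ` space M)"
    by (rule finite_subset[of _ "{Success, Loss}"]) (use outcome.exhaust in auto)
  ultimately show ?thesis by (auto simp: simple_function_def intro: measurable_sets)
qed

text \<open>Only finitely many outcome histories precede time \<open>k\<close>, so the state takes finitely many values. This makes
  every real function of the state integrable.\<close>

lemma simple_function_chain: "simple_function M (X k)"
proof (induction k)
  case 0
  have "X 0 = (\<lambda>\<omega>. s0)" using X_0 by auto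
  then show ?case by simp
next
  case (Suc k)
  have "X (Suc k) = (\<lambda>\<omega>. g (net (Suc k) \<omega>) (X k \<omega>))" using X_Suc by auto
  then show ?case using simple_function_compose2[OF simple_function_net Suc, of g "Suc k"] by simp
qed

lemma integrable_chain: "integrable M (\<lambda>\<omega>. h (X k \<omega>))" for h :: "'s \<Rightarrow> real"
  by (rule integrable_simple_function[OF simple_function_compose1[OF simple_function_chain]])

lemma integrable_chain_prod:
  fixes h :: "'s \<Rightarrow> real" and \<phi> :: "nat \<Rightarrow> outcome \<Rightarrow> real"
  shows "integrable M (\<lambda>\<omega>. h (X k \<omega>) * (\<Prod>j\<in>J. \<phi> j (net j \<omega>)))"
proof (intro integrable_simple_function simple_function_mult)
  show "simple_function M (\<lambda>\<omega>. h (X k \<omega>))"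
    by (rule simple_function_compose1[OF simple_function_chain])
  show "simple_function M (\<lambda>\<omega>. \<Prod>j\<in>J. \<phi> j (net j \<omega>))"
    by (induction J rule: infinite_finite_induct)
      (simp_all add: simple_function_mult simple_function_compose1[OF simple_function_net])
qed

text \<open>The state at time \<open>k\<close> depends on the outcomes up to time \<open>k\<close> only, so it is independent of later ones.
  Allowing an arbitrary product of functions of later outcomes makes the induction work: the last
  outcome entering the state is split off by cases and joins that product.\<close>

lemma expectation_chain_prod:
  fixes h :: "'s \<Rightarrow> real" and \<phi> :: "nat \<Rightarrow> outcome \<Rightarrow> real"
  assumes "finite J" "J \<subseteq> {k<..}"
  shows "(\<integral>\<omega>. h (X k \<omega>) * (\<Prod>j\<in>J. \<phi> j (net j \<omega>)) \<partial>M) =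
    (\<integral>\<omega>. h (X k \<omega>) \<partial>M) * (\<Prod>j\<in>J. \<integral>\<omega>. \<phi> j (net j \<omega>) \<partial>M)"
  using assms
proof (induction k arbitrary: h J \<phi>)
  case 0
  have "(\<integral>\<omega>. (\<Prod>j\<in>J. \<phi> j (net j \<omega>)) \<partial>M) = (\<Prod>j\<in>J. \<integral>\<omega>. \<phi> j (net j \<omega>) \<partial>M)"
  proof (rule indep_vars_lebesgue_integral)
    show "indep_vars (\<lambda>_. borel) (\<lambda>j \<omega>. \<phi> j (net j \<omega>)) J"
      by (rule indep_vars_compose2[OF indep_vars_subset[OF indep]]) auto
    show "integrable M (\<lambda>\<omega>. \<phi> j (net j \<omega>))" for j
      by (rule integrable_simple_function[OF simple_function_compose1[OF simple_function_net]])
  qed fact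
  then show ?case by (simp add: X_0 prob_space)
next
  case (Suc k)
  \<comment> \<open>The factor at time \<open>k + 1\<close> selects one outcome; the given factors stay in place.\<close>
  define \<psi> where "\<psi> out j = (if j = Suc k then (\<lambda>out'. of_bool (out' = out)) else \<phi> j)"
    for out and j :: nat
  have notin: "Suc k \<notin> J" using Suc.prems by auto
  have split: "(\<integral>\<omega>. h (X (Suc k) \<omega>) * (\<Prod>j\<in>J'. \<phi> j (net j \<omega>)) \<partial>M) =
      (\<Sum>out\<in>{Success, Loss}. (\<integral>\<omega>. h (g out (X k \<omega>)) \<partial>M) *
        (\<integral>\<omega>. of_bool (net (Suc k) \<omega> = out) \<partial>M)) * (\<Prod>j\<in>J'. \<integral>\<omega>. \<phi> j (net j \<omega>) \<partial>M)"
    if J': "J' \<subseteq> J" for J'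
  proof -
    have fin: "finite J'" and notin': "Suc k \<notin> J'" using J' notin Suc.prems finite_subset by auto
    have \<psi>: "\<psi> out j = \<phi> j" if "j \<in> J'" for j out
      using that notin' by (auto simp: \<psi>_def)
    have "h (X (Suc k) \<omega>) * (\<Prod>j\<in>J'. \<phi> j (net j \<omega>)) =
        (\<Sum>out\<in>{Success, Loss}. h (g out (X k \<omega>)) * (\<Prod>j\<in>insert (Suc k) J'. \<psi> out j (net j \<omega>)))" for \<omega>
      using fin notin' by (cases "net (Suc k) \<omega>") (simp_all add: X_Suc \<psi> \<psi>_def[of _ "Suc k"])
    then have "(\<integral>\<omega>. h (X (Suc k) \<omega>) * (\<Prod>j\<in>J'. \<phi> j (net j \<omega>)) \<partial>M) =
        (\<Sum>out\<in>{Success, Loss}. \<integral>\<omega>. h (g out (X k \<omega>)) *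
          (\<Prod>j\<in>insert (Suc k) J'. \<psi> out j (net j \<omega>)) \<partial>M)"
      by (simp only:) (intro Bochner_Integration.integral_sum integrable_chain_prod[where h = "\<lambda>s. h (g _ s)"])
    also have "\<dots> = (\<Sum>out\<in>{Success, Loss}. (\<integral>\<omega>. h (g out (X k \<omega>)) \<partial>M) *
          (\<Prod>j\<in>insert (Suc k) J'. \<integral>\<omega>. \<psi> out j (net j \<omega>) \<partial>M))"
    proof (intro sum.cong refl)
      fix out
      have "insert (Suc k) J' \<subseteq> {k<..}" using J' Suc.prems by auto
      from Suc.IH[OF _ this, of "\<lambda>s. h (g out s)" "\<psi> out"] fin
      show "(\<integral>\<omega>. h (g out (X k \<omega>)) * (\<Prod>j\<in>insert (Suc k) J'. \<psi> out j (net j \<omega>)) \<partial>M) =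
        (\<integral>\<omega>. h (g out (X k \<omega>)) \<partial>M) * (\<Prod>j\<in>insert (Suc k) J'. \<integral>\<omega>. \<psi> out j (net j \<omega>) \<partial>M)"
        by blast
    qed
    also have "\<dots> = (\<Sum>out\<in>{Success, Loss}. (\<integral>\<omega>. h (g out (X k \<omega>)) \<partial>M) *
          (\<integral>\<omega>. of_bool (net (Suc k) \<omega> = out) \<partial>M) * (\<Prod>j\<in>J'. \<integral>\<omega>. \<phi> j (net j \<omega>) \<partial>M))"
      using fin notin' by (intro sum.cong refl) (simp add: \<psi> \<psi>_def[of _ "Suc k"])
    finally show ?thesis by (simp only: sum_distrib_right)
  qed
  \<comment> \<open>The instance with no further factors identifies the sum over the outcomes as the expectation.\<close>
  show ?case using split[of J] split[of "{}"] by simp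
qed

text \<open>The Markov property in the form needed for a Lyapunov argument: conditioning on the next outcome
  averages the cost over the two possible updates of the current state.\<close>

lemma expectation_chain_Suc:
  fixes h :: "'s \<Rightarrow> real"
  shows "(\<integral>\<omega>. h (X (Suc k) \<omega>) \<partial>M) = (\<Sum>out\<in>{Success, Loss}.
    prob {\<omega> \<in> space M. net (Suc k) \<omega> = out} * (\<integral>\<omega>. h (g out (X k \<omega>)) \<partial>M))"
proof -
  have ind: "(\<integral>\<omega>. of_bool (net (Suc k) \<omega> = out) \<partial>M) = prob {\<omega> \<in> space M. net (Suc k) \<omega> = out}" for out
  proof -
    have "(\<integral>\<omega>. of_bool (net (Suc k) \<omega> = out) \<partial>M :: real) =
        (\<integral>\<omega>. indicator {\<omega> \<in> space M. net (Suc k) \<omega> = out} \<omega> \<partial>M)"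
      by (intro Bochner_Integration.integral_cong) (auto simp: indicator_def)
    also have "\<dots> = prob ({\<omega> \<in> space M. net (Suc k) \<omega> = out} \<inter> space M)" by simp
    also have "{\<omega> \<in> space M. net (Suc k) \<omega> = out} \<inter> space M = {\<omega> \<in> space M. net (Suc k) \<omega> = out}"
      by auto
    finally show ?thesis .
  qed
  have product: "(\<integral>\<omega>. h (g out (X k \<omega>)) * of_bool (net (Suc k) \<omega> = out) \<partial>M) =
      (\<integral>\<omega>. h (g out (X k \<omega>)) \<partial>M) * prob {\<omega> \<in> space M. net (Suc k) \<omega> = out}" for out
    using expectation_chain_prod[of "{Suc k}" k "\<lambda>s. h (g out s)" "\<lambda>_ out'. of_bool (out' = out)"]
    by (simp add: ind)
  have int: "integrable M (\<lambda>\<omega>. h (g out (X k \<omega>)) * of_bool (net (Suc k) \<omega> = out))" for out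
    using integrable_chain_prod[of "\<lambda>s. h (g out s)" k "\<lambda>_ out'. of_bool (out' = out)" "{Suc k}"]
    by simp
  have "h (X (Suc k) \<omega>) = (\<Sum>out\<in>{Success, Loss}. h (g out (X k \<omega>)) * of_bool (net (Suc k) \<omega> = out))" for \<omega>
    by (cases "net (Suc k) \<omega>") (simp_all add: X_Suc)
  then have "(\<integral>\<omega>. h (X (Suc k) \<omega>) \<partial>M) = (\<Sum>out\<in>{Success, Loss}.
      \<integral>\<omega>. h (g out (X k \<omega>)) * of_bool (net (Suc k) \<omega> = out) \<partial>M)"
    by (simp only:) (intro Bochner_Integration.integral_sum int)
  then show ?thesis by (simp only: product mult.commute)
qed

end

text \<open>The expectations are summable, so by monotone convergence \<open>\<Sum>k. Y k \<omega>\<close> is finite for almost every \<open>\<omega>\<close>,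
  and the terms of a convergent series tend to zero.\<close>

lemma AE_tendsto_zero_if_geometric_expectation:
  fixes Y :: "nat \<Rightarrow> 'a \<Rightarrow> real"
  assumes int: "\<And>k. integrable M (Y k)" and nonneg: "\<And>k \<omega>. 0 \<le> Y k \<omega>"
    and bound: "\<And>k. (\<integral>\<omega>. Y k \<omega> \<partial>M) \<le> c * q ^ k" and q: "0 \<le> q" "q < 1"
  shows "AE \<omega> in M. (\<lambda>k. Y k \<omega>) \<longlonglongrightarrow> 0"
proof -
  have sum: "summable (\<lambda>k. c * q ^ k)" using q by (intro summable_mult summable_geometric) simp
  have c: "0 \<le> c * q ^ k" for k
    using order_trans[OF Bochner_Integration.integral_nonneg[of M "Y k"] bound[of k]] nonneg by blast
  have [measurable]: "Y k \<in> borel_measurable M" for k using int by auto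
  have "(\<integral>\<^sup>+\<omega>. (\<Sum>k. ennreal (Y k \<omega>)) \<partial>M) = (\<Sum>k. \<integral>\<^sup>+\<omega>. ennreal (Y k \<omega>) \<partial>M)"
    by (intro nn_integral_suminf) auto
  also have "\<dots> \<le> (\<Sum>k. ennreal (c * q ^ k))"
    using bound nonneg int by (intro suminf_le) (auto simp: nn_integral_eq_integral ennreal_leI)
  also have "\<dots> = ennreal (\<Sum>k. c * q ^ k)" by (rule suminf_ennreal2[OF c sum])
  also have "\<dots> < \<infinity>" by simp
  finally have "AE \<omega> in M. (\<Sum>k. ennreal (Y k \<omega>)) \<noteq> \<infinity>"
    by (intro nn_integral_PInf_AE) auto
  then show ?thesis
  proof eventually_elim
    case (elim \<omega>)
    then have "summable (\<lambda>k. Y k \<omega>)" using nonneg by (intro summable_suminf_not_top) auto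
    then show ?case by (rule summable_LIMSEQ_zero)
  qed
qed

end

section \<open>Convergence\<close>

lemma x_out_diff: "x_out lap (\<xi> - \<xi>') = x_out lap \<xi> - x_out lap \<xi>'"
  by (cases \<xi>; cases \<xi>') (simp add: matrix_vector_mult_diff_distrib)

lemma x_out_bounded:
  fixes lap :: "real^'n^'n"
  obtains c where "\<And>\<xi>. norm (x_out lap \<xi>) \<le> c * norm \<xi>"
proof
  let ?c = "1 + onorm ((*v) lap)"
  note bl = matrix_vector_mul_bounded_linear[of lap]
  show "norm (x_out lap \<xi>) \<le> ?c * norm \<xi>" for \<xi>
  proof (cases \<xi>)
    case (fields w1 w2 r)
    have n: "norm w1 \<le> norm \<xi>" "norm r \<le> norm \<xi>"
      unfolding fields using norm_fst_le[of w1 "(w2, r)"] norm_snd_le[of "(w2, r)" w1] norm_snd_le[of r w2] by auto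
    have "norm (lap *v r) \<le> onorm ((*v) lap) * norm \<xi>"
      using onorm[OF bl, of r] n(2) onorm_pos_le[OF bl] by (meson mult_left_mono order_trans)
    then show ?thesis using norm_triangle_ineq4[of w1 "lap *v r"] n(1)
      by (simp add: fields distrib_right)
  qed
qed

theorem theorem3:
  fixes f :: "'n::finite \<Rightarrow> real \<Rightarrow> real"
    and x_opt \<mu> L :: real
    and G :: "'n pair_pre_digraph" and wt :: "'n \<Rightarrow> 'n \<Rightarrow> real"
    and lap :: "real^'n^'n" and \<sigma> :: real
    and \<alpha> \<delta> \<zeta> \<eta> pl :: real
    and \<Omega> :: "'w measure" and net :: "nat \<Rightarrow> 'w \<Rightarrow> outcome"
    and P Q :: "real^3^3" and l0 l1 \<rho> :: real
  assumes diff: "\<And>i x. f i differentiable (at x)"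
    and conv: "\<And>i. convex_on UNIV (f i)"
    and opt_min: "is_arg_min (\<lambda>\<theta>. \<Sum>i\<in>UNIV. f i \<theta>) (\<lambda>_. True) x_opt"
    and opt_unique: "\<And>z. is_arg_min (\<lambda>\<theta>. \<Sum>i\<in>UNIV. f i \<theta>) (\<lambda>_. True) z \<Longrightarrow> z = x_opt"
    and opt_grad: "(\<Sum>i\<in>UNIV. deriv (f i) x_opt) = 0"
    and mu_L: "0 < \<mu>" "\<mu> \<le> L"
    and A1: "\<And>i x. let a = x - x_opt; b = deriv (f i) x - deriv (f i) x_opt
                in - 2 * \<mu> * L * a\<^sup>2 + 2 * (L + \<mu>) * a * b - 2 * b\<^sup>2 \<ge> 0"
    and graph: "pair_fin_digraph G" "pverts G = UNIV"
    and lap: "lap = laplacian G wt"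
    and A2: "strongly_connected (with_proj G)"
    and A3: "vec 1 v* lap = 0"
    and sigma: "\<sigma> = spectral_norm (mat 1 - avg_proj - lap)"
    and A4: "\<sigma> < 1"
    and prob: "prob_space \<Omega>"
    and net_indep: "prob_space.indep_vars \<Omega> (\<lambda>_. count_space UNIV) net UNIV"
    and net_loss: "\<And>k. measure \<Omega> {\<omega> \<in> space \<Omega>. net k \<omega> = Loss} = pl"
    and P: "pos_def P" and Q: "pos_def Q"
    and lambda: "l0 \<ge> 0" "l1 \<ge> 0" and rho: "\<rho> \<in> {0<..<1}"
    and lmi_P: "neg_semidef (lmi_p \<mu> L \<alpha> \<delta> pl P l0 \<rho>)"
    and lmi_Q: "neg_semidef (lmi_q \<mu> L \<sigma> \<alpha> \<delta> \<zeta> \<eta> pl Q l0 l1 \<rho>)"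
  shows "(\<exists>w1 w2 r x y u v.
            is_fixed_point f lap \<alpha> \<delta> \<zeta> \<eta> w1 w2 r x y u v \<and>
            (\<forall>\<xi>0 k.
               let \<xi> = (\<lambda>\<omega>. traj f lap \<alpha> \<delta> \<zeta> \<eta> \<xi>0 (\<lambda>t. net t \<omega>) k);
                   T = P \<otimes>\<^sub>K avg_proj + Q \<otimes>\<^sub>K (mat 1 - avg_proj :: real^'n^'n)
               in integrable \<Omega> (\<lambda>\<omega>. (norm (\<xi> \<omega> - (w1, w2, r)))\<^sup>2) \<and>
                  (\<integral>\<omega>. (norm (\<xi> \<omega> - (w1, w2, r)))\<^sup>2 \<partial>\<Omega>)
                    \<le> cond T * \<rho> ^ (2 * k) * (norm (\<xi>0 - (w1, w2, r)))\<^sup>2)) \<and>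
         (\<forall>\<xi>0.
            let X = (\<lambda>k \<omega>. x_out lap (traj f lap \<alpha> \<delta> \<zeta> \<eta> \<xi>0 (\<lambda>t. net t \<omega>) k))
            in (\<exists>c. \<forall>k. integrable \<Omega> (\<lambda>\<omega>. (norm (X k \<omega> - vec x_opt))\<^sup>2) \<and>
                        (\<integral>\<omega>. (norm (X k \<omega> - vec x_opt))\<^sup>2 \<partial>\<Omega>) \<le> c * \<rho> ^ (2 * k)) \<and>
               (AE \<omega> in \<Omega>. (\<lambda>k. X k \<omega>) \<longlonglongrightarrow> vec x_opt))"
proof -
  interpret prob_space \<Omega> by (rule prob)
  have ones: "lap *v 1 = 0" by (simp add: lap laplacian_mult_one)
  have mean0: "mean (lap *v r) = 0" for r using A3 by (rule mean_lap_zero)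
  obtain w1 w2 r y u v
    where fp: "is_fixed_point f lap \<alpha> \<delta> \<zeta> \<eta> w1 w2 r (vec x_opt) y u v"
    using optimal_fixed_point[OF ones mean0 A4[unfolded sigma] opt_grad
        lmi_q_imp_zeta_nonzero[OF Q lmi_Q lambda(2) rho] lmi_q_imp_eta_nonzero[OF Q lmi_Q lambda(2) rho]] .
  define \<xi>s where "\<xi>s = (w1, w2, r)"
  have x_opt: "x_out lap \<xi>s = vec x_opt" using fp by (simp add: \<xi>s_def is_fixed_point_def)
  \<comment> \<open>The Lyapunov function of the state, whose expected value contracts by \<open>\<rho>\<^sup>2\<close> in each step.\<close>
  define T :: "real^(3 \<times> 'n)^(3 \<times> 'n)" where "T = lyapunov P Q"
  define V where "V \<xi> = qf T (stack (\<xi> - \<xi>s))" for \<xi>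
  obtain lo where lo: "0 < lo" "\<And>x. lo * (norm x)\<^sup>2 \<le> qf T x" "\<And>x. qf T x \<le> cond T * lo * (norm x)\<^sup>2"
    using pos_def_cond[OF pos_def_lyapunov[OF P Q, where 'n = 'n]] unfolding T_def by blast
  let ?step = "step f lap \<alpha> \<delta> \<zeta> \<eta>"
  let ?X = "\<lambda>\<xi>0 k \<omega>. traj f lap \<alpha> \<delta> \<zeta> \<eta> \<xi>0 (\<lambda>t. net t \<omega>) k"
  have decrease: "(\<Sum>out\<in>{Success, Loss}. prob_out pl out * V (?step out \<xi>)) \<le> \<rho>\<^sup>2 * V \<xi>" for \<xi>
  proof -
    define du where "du = gradF f (x_out lap \<xi>) - gradF f (x_out lap \<xi>s)"
    have "?step out \<xi> - \<xi>s = linear_step lap \<alpha> \<delta> \<zeta> \<eta> out du (\<xi> - \<xi>s)" for out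
    proof -
      have "?step out \<xi> - \<xi>s = ?step out \<xi> - ?step out \<xi>s"
        unfolding \<xi>s_def step_fixed_point[OF fp] ..
      then show ?thesis by (simp only: step_eq_linear_step linear_step_diff du_def)
    qed
    moreover have "0 \<le> gradient_form \<mu> L (x_out lap (\<xi> - \<xi>s) $ i) (du $ i)" for i
      using A1[of "x_out lap \<xi> $ i" i]
      by (simp add: gradient_form_def Let_def x_out_diff x_opt du_def gradF_def)
    ultimately show ?thesis
      unfolding V_def T_def
      using expected_lyapunov_decrease[OF lmi_P lmi_Q lambda ones mean0 sigma] by simp
  qed
  have prob_net: "prob {\<omega> \<in> space \<Omega>. net k \<omega> = out} = prob_out pl out" for k out
  proof (cases out)
    case Success
    have "{\<omega> \<in> space \<Omega>. net k \<omega> = Loss} \<in> events"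
    proof -
      have "net k \<in> measurable \<Omega> (count_space UNIV)" using net_indep by (simp add: indep_vars_def)
      then show ?thesis by measurable
    qed
    moreover have "net k \<omega> = Success \<longleftrightarrow> net k \<omega> \<noteq> Loss" for \<omega> by (cases "net k \<omega>") simp_all
    then have "{\<omega> \<in> space \<Omega>. net k \<omega> = Success} = space \<Omega> - {\<omega> \<in> space \<Omega>. net k \<omega> = Loss}"
      by auto
    ultimately show ?thesis using net_loss by (simp add: prob_compl Success)
  qed (simp add: net_loss)
  note chain = net_indep traj.simps(1) traj.simps(2)
  have integrable_state: "integrable \<Omega> (\<lambda>\<omega>. h (?X \<xi>0 k \<omega>))" for h :: "'n state \<Rightarrow> real" and \<xi>0 k
    by (rule integrable_chain[where X = "?X \<xi>0", OF chain])
  have EV: "(\<integral>\<omega>. V (?X \<xi>0 k \<omega>) \<partial>\<Omega>) \<le> \<rho> ^ (2 * k) * V \<xi>0" for \<xi>0 k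
  proof (induction k)
    case 0
    then show ?case by (simp add: prob_space)
  next
    case (Suc k)
    have int_next: "integrable \<Omega> (\<lambda>\<omega>. V (?step out (?X \<xi>0 k \<omega>)))" for out
      by (rule integrable_state[of "\<lambda>\<xi>. V (?step out \<xi>)"])
    have "(\<integral>\<omega>. V (?X \<xi>0 (Suc k) \<omega>) \<partial>\<Omega>) =
        (\<Sum>out\<in>{Success, Loss}. prob_out pl out * (\<integral>\<omega>. V (?step out (?X \<xi>0 k \<omega>)) \<partial>\<Omega>))"
      using expectation_chain_Suc[where X = "?X \<xi>0", OF chain, of V] by (simp only: prob_net)
    also have "\<dots> = (\<integral>\<omega>. (\<Sum>out\<in>{Success, Loss}. prob_out pl out * V (?step out (?X \<xi>0 k \<omega>))) \<partial>\<Omega>)"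
      by (subst Bochner_Integration.integral_sum)
        (simp_all add: int_next del: step.simps)
    also have "\<dots> \<le> (\<integral>\<omega>. \<rho>\<^sup>2 * V (?X \<xi>0 k \<omega>) \<partial>\<Omega>)"
      by (intro integral_mono decrease integrable_state[of "\<lambda>\<xi>. \<rho>\<^sup>2 * V \<xi>"]
          integrable_state[of "\<lambda>\<xi>. \<Sum>out\<in>{Success, Loss}. prob_out pl out * V (?step out \<xi>)"])
    also have "\<dots> = \<rho>\<^sup>2 * (\<integral>\<omega>. V (?X \<xi>0 k \<omega>) \<partial>\<Omega>)" by simp
    also have "\<dots> \<le> \<rho>\<^sup>2 * (\<rho> ^ (2 * k) * V \<xi>0)" by (intro mult_left_mono Suc.IH) simp
    finally show ?case by (simp add: power2_eq_square)
  qed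
  have state_bound: "(\<integral>\<omega>. (norm (?X \<xi>0 k \<omega> - \<xi>s))\<^sup>2 \<partial>\<Omega>)
      \<le> cond T * \<rho> ^ (2 * k) * (norm (\<xi>0 - \<xi>s))\<^sup>2" for \<xi>0 k
  proof -
    have "lo * (\<integral>\<omega>. (norm (?X \<xi>0 k \<omega> - \<xi>s))\<^sup>2 \<partial>\<Omega>) = (\<integral>\<omega>. lo * (norm (?X \<xi>0 k \<omega> - \<xi>s))\<^sup>2 \<partial>\<Omega>)"
      by simp
    also have "\<dots> \<le> (\<integral>\<omega>. V (?X \<xi>0 k \<omega>) \<partial>\<Omega>)"
      using lo(2)[of "stack _"]
      by (intro integral_mono integrable_state[of V] integrable_state[of "\<lambda>\<xi>. lo * (norm (\<xi> - \<xi>s))\<^sup>2"])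
        (simp add: V_def norm_stack)
    also have "\<dots> \<le> \<rho> ^ (2 * k) * V \<xi>0" by (rule EV)
    also have "\<dots> \<le> \<rho> ^ (2 * k) * (cond T * lo * (norm (\<xi>0 - \<xi>s))\<^sup>2)"
      using lo(3)[of "stack (\<xi>0 - \<xi>s)"] by (intro mult_left_mono) (simp_all add: V_def norm_stack)
    also have "\<dots> = lo * (cond T * \<rho> ^ (2 * k) * (norm (\<xi>0 - \<xi>s))\<^sup>2)" by simp
    finally show ?thesis using lo(1) by simp
  qed
  obtain C where C: "\<And>\<xi>. norm (x_out lap \<xi>) \<le> C * norm \<xi>" using x_out_bounded[of lap] by blast
  have out_bound: "(\<integral>\<omega>. (norm (x_out lap (?X \<xi>0 k \<omega>) - vec x_opt))\<^sup>2 \<partial>\<Omega>)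
      \<le> (C\<^sup>2 * (cond T * (norm (\<xi>0 - \<xi>s))\<^sup>2)) * \<rho> ^ (2 * k)" for \<xi>0 k
  proof -
    have "(norm (x_out lap \<xi> - vec x_opt))\<^sup>2 \<le> C\<^sup>2 * (norm (\<xi> - \<xi>s))\<^sup>2" for \<xi>
      using power_mono[OF C[of "\<xi> - \<xi>s"], of 2] by (simp add: x_out_diff x_opt power_mult_distrib)
    then have "(\<integral>\<omega>. (norm (x_out lap (?X \<xi>0 k \<omega>) - vec x_opt))\<^sup>2 \<partial>\<Omega>)
        \<le> (\<integral>\<omega>. C\<^sup>2 * (norm (?X \<xi>0 k \<omega> - \<xi>s))\<^sup>2 \<partial>\<Omega>)"
      by (intro integral_mono integrable_state[of "\<lambda>\<xi>. (norm (x_out lap \<xi> - vec x_opt))\<^sup>2"]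
          integrable_state[of "\<lambda>\<xi>. C\<^sup>2 * (norm (\<xi> - \<xi>s))\<^sup>2"])
    also have "\<dots> = C\<^sup>2 * (\<integral>\<omega>. (norm (?X \<xi>0 k \<omega> - \<xi>s))\<^sup>2 \<partial>\<Omega>)" by simp
    also have "\<dots> \<le> C\<^sup>2 * (cond T * \<rho> ^ (2 * k) * (norm (\<xi>0 - \<xi>s))\<^sup>2)"
      by (intro mult_left_mono state_bound) simp
    finally show ?thesis by (simp add: mult_ac)
  qed
  have integrable_out: "integrable \<Omega> (\<lambda>\<omega>. (norm (x_out lap (?X \<xi>0 k \<omega>) - vec x_opt))\<^sup>2)" for \<xi>0 k
    by (rule integrable_state[of "\<lambda>\<xi>. (norm (x_out lap \<xi> - vec x_opt))\<^sup>2"])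
  have "AE \<omega> in \<Omega>. (\<lambda>k. x_out lap (?X \<xi>0 k \<omega>)) \<longlonglongrightarrow> vec x_opt" for \<xi>0
  proof -
    have "AE \<omega> in \<Omega>. (\<lambda>k. (norm (x_out lap (?X \<xi>0 k \<omega>) - vec x_opt))\<^sup>2) \<longlonglongrightarrow> 0"
      using rho by (intro AE_tendsto_zero_if_geometric_expectation[
            OF integrable_out _ out_bound[unfolded power_mult]])
        (auto simp: power_less_one_iff abs_square_less_1)
    then show ?thesis
    proof eventually_elim
      case (elim \<omega>)
      from tendsto_real_sqrt[OF this] show ?case by (simp add: LIM_zero_iff tendsto_norm_zero_iff)
    qed
  qed
  then show ?thesis
    using fp state_bound[unfolded \<xi>s_def T_def lyapunov_def] integrable_out out_bound
      integrable_state[of "\<lambda>\<xi>. (norm (\<xi> - (w1, w2, r)))\<^sup>2"]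
    unfolding Let_def by blast
qed

end
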